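(* Let $I$ be the pullback shape category $\{\bullet\to\bullet\leftarrow\bullet\}$. Let $\mathcal{A}$ be the $2$-category generated by objects $X,L,A,B,C$; morphisms $f\colon X\to L$, $\lambda_0\colon L\to B$, $\lambda_1\colon L\to C$, $\alpha_0\colon X\to B$, $\alpha_1\colon X\to C$, $b\colon B\to A$, $c\colon C\to A$; and $2$-morphisms $\gamma_0\colon\lambda_0 f\Rightarrow\alpha_0$ and $\gamma_1\colon\lambda_1 f\Rightarrow\alpha_1$; subject to the relations $b\lambda_0=c\lambda_1$ and $b\alpha_0=c\alpha_1$. Let $F\colon I\to\mathcal{A}$ be the diagram $B\xrightarrow{b}A\xleftarrow{c}C$, and let $\lambda\colon\Delta L\Rightarrow F$ be the $2$-cone with components $\lambda_0$ at $B$, $\lambda_1$ at $C$ and $b\lambda_0=c\lambda_1$ at $A$. Then $(L,\lambda)$ is $2$-terminal in the lax-slice $\Delta\downarrow_l F$ of $2$-cones over $F$, but the functor $\lambda_*\circ\Delta\colon\mathcal{A}(X,L)\to[I,\mathcal{A}](\Delta X,F)$ given by post-composition with $\lambda$ is not surjective on objects; i.e. $(L,\lambda)$ is not a $2$-limit of $F$.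
   Context: $2$-categories and $2$-functors are strict; $*$ denotes horizontal composition (and whiskering) of $2$-morphisms and juxtaposition denotes vertical composition. "Generated by the data subject to relations" means the $2$-category freely generated by the listed objects, morphisms and $2$-morphisms, modulo the listed relations. The $1$-category $I$ is regarded as a $2$-category with only identity $2$-morphisms. A $2$-natural transformation $\mu\colon F\Rightarrow G$ between $2$-functors $F,G\colon I\to\mathcal{A}$ consists of morphisms $\mu_i\colon Fi\to Gi$ with $(Gf)\mu_i=\mu_j(Ff)$ for every $f\colon i\to j$ in $I$ and $G\alpha*\mu_i=\mu_j*F\alpha$ for every $2$-morphism $\alpha$ in $I$. A modification $\varphi\colon\mu\to\nu$ consists of $2$-morphisms $\varphi_i\colon\mu_i\Rightarrow\nu_i$ with $Gf*\varphi_i=\varphi_j*Ff$ for every $f\colon i\to j$. $[I,\mathcal{A}]$ is the $2$-category of $2$-functors, $2$-natural transformations and modifications; $\Delta X$ is the constant $2$-functor at $X$; a $2$-cone over $F$ is a $2$-natural transformation $\Delta X\Rightarrow F$. A $2$-limit of $F$ is a pair $(L,\lambda\colon\Delta L\Rightarrow F)$ with $\lambda$ a $2$-cone such that for each $X\in\mathcal{A}$ the functor $\lambda_*\circ\Delta\colon\mathcal{A}(X,L)\to[I,\mathcal{A}](\Delta X,F)$ is an isomorphism of categories. The lax-slice $\Delta\downarrow_l F$ of $2$-cones is the $2$-category whose objects are pairs $(X,\mu)$ with $\mu\colon\Delta X\Rightarrow F$ a $2$-cone; morphisms $(X,\mu)\to(Y,\nu)$ are pairs $(f,\varphi)$ of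 a morphism $f\colon X\to Y$ in $\mathcal{A}$ and a modification $\varphi\colon\nu\Delta f\to\mu$; $2$-morphisms $(f,\varphi)\Rightarrow(g,\psi)$ are $2$-morphisms $\alpha\colon f\Rightarrow g$ in $\mathcal{A}$ with $\psi(\nu*\Delta\alpha)=\varphi$. An object $L$ of a $2$-category $\mathcal{B}$ is $2$-terminal if for all $X\in\mathcal{B}$ the category $\mathcal{B}(X,L)$ is isomorphic to the terminal category $\mathbb{1}$.
   Formalization: The relation b*γ₀ = c*γ₁ is added to the listed relations; without it (γ₀, γ₁) is not a modification, there is no morphism (X, α) → (L, λ) in the lax slice, and (L, λ) is not 2-terminal. *)

theory Defs
  imports "HOL-Library.FuncSet"
begin

section \<open>Categories\<close>

record ('o, 'a) cat =
  Ob :: "'o set"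
  Ar :: "'a set"
  dom :: "'a \<Rightarrow> 'o"
  cod :: "'a \<Rightarrow> 'o"
  ide :: "'o \<Rightarrow> 'a"
  cmp :: "'a \<Rightarrow> 'a \<Rightarrow> 'a"

locale category =
  fixes C :: "('o, 'a) cat"
  assumes dom_in: "f \<in> Ar C \<Longrightarrow> dom C f \<in> Ob C"
    and cod_in: "f \<in> Ar C \<Longrightarrow> cod C f \<in> Ob C"
    and ide_in: "x \<in> Ob C \<Longrightarrow> ide C x \<in> Ar C"
    and dom_ide: "x \<in> Ob C \<Longrightarrow> dom C (ide C x) = x"
    and cod_ide: "x \<in> Ob C \<Longrightarrow> cod C (ide C x) = x"
    and cmp_in: "\<lbrakk>f \<in> Ar C; g \<in> Ar C; cod C f = dom C g\<rbrakk> \<Longrightarrow> cmp C g f \<in> Ar C"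
    and dom_cmp: "\<lbrakk>f \<in> Ar C; g \<in> Ar C; cod C f = dom C g\<rbrakk> \<Longrightarrow> dom C (cmp C g f) = dom C f"
    and cod_cmp: "\<lbrakk>f \<in> Ar C; g \<in> Ar C; cod C f = dom C g\<rbrakk> \<Longrightarrow> cod C (cmp C g f) = cod C g"
    and cmp_ide_left: "f \<in> Ar C \<Longrightarrow> cmp C (ide C (cod C f)) f = f"
    and cmp_ide_right: "f \<in> Ar C \<Longrightarrow> cmp C f (ide C (dom C f)) = f"
    and cmp_assoc: "\<lbrakk>f \<in> Ar C; g \<in> Ar C; h \<in> Ar C; cod C f = dom C g; cod C g = dom C h\<rbrakk>
      \<Longrightarrow> cmp C h (cmp C g f) = cmp C (cmp C h g) f"

record ('o, 'a, 'p, 'b) func =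
  on_ob :: "'o \<Rightarrow> 'p"
  on_ar :: "'a \<Rightarrow> 'b"

definition is_functor :: "('o, 'a) cat \<Rightarrow> ('p, 'b) cat \<Rightarrow> ('o, 'a, 'p, 'b) func \<Rightarrow> bool" where
  "is_functor C D T \<longleftrightarrow>
     on_ob T \<in> Ob C \<rightarrow> Ob D \<and> on_ar T \<in> Ar C \<rightarrow> Ar D \<and>
     (\<forall>f\<in>Ar C. dom D (on_ar T f) = on_ob T (dom C f) \<and> cod D (on_ar T f) = on_ob T (cod C f)) \<and>
     (\<forall>x\<in>Ob C. on_ar T (ide C x) = ide D (on_ob T x)) \<and>
     (\<forall>f\<in>Ar C. \<forall>g\<in>Ar C. cod C f = dom C g \<longrightarrow>
        on_ar T (cmp C g f) = cmp D (on_ar T g) (on_ar T f))"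

definition is_iso_functor :: "('o, 'a) cat \<Rightarrow> ('p, 'b) cat \<Rightarrow> ('o, 'a, 'p, 'b) func \<Rightarrow> bool" where
  "is_iso_functor C D T \<longleftrightarrow> is_functor C D T \<and>
     (\<exists>S. is_functor D C S \<and>
        (\<forall>x\<in>Ob C. on_ob S (on_ob T x) = x) \<and> (\<forall>f\<in>Ar C. on_ar S (on_ar T f) = f) \<and>
        (\<forall>y\<in>Ob D. on_ob T (on_ob S y) = y) \<and> (\<forall>g\<in>Ar D. on_ar T (on_ar S g) = g))"

definition isomorphic_cats :: "('o, 'a) cat \<Rightarrow> ('p, 'b) cat \<Rightarrow> bool" where
  "isomorphic_cats C D \<longleftrightarrow> (\<exists>T. is_iso_functor C D T)"

definition surjective_on_objects ::
    "('o, 'a) cat \<Rightarrow> ('p, 'b) cat \<Rightarrow> ('o, 'a, 'p, 'b) func \<Rightarrow> bool" where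
  "surjective_on_objects C D T \<longleftrightarrow> (\<forall>y\<in>Ob D. \<exists>x\<in>Ob C. on_ob T x = y)"

definition terminal_cat :: "(unit, unit) cat" where
  "terminal_cat = \<lparr>Ob = UNIV, Ar = UNIV, dom = (\<lambda>_. ()), cod = (\<lambda>_. ()),
     ide = (\<lambda>_. ()), cmp = (\<lambda>_ _. ())\<rparr>"

section \<open>Strict 2-categories\<close>

text \<open>Compositions are written in applicative order: the right-hand operand comes first.
  \<open>g \<cdot> f\<close> is composition of morphisms, \<open>\<beta> \<bullet> \<alpha>\<close> vertical and \<open>\<beta> \<star> \<alpha>\<close> horizontal
  composition of 2-morphisms.  Whiskering with a morphism is horizontal composition with its
  identity 2-morphism.\<close>

record ('o, 'm, 'c) two_cat =
  Obj :: "'o set"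
  Mor :: "'m set"
  Src :: "'m \<Rightarrow> 'o"
  Tgt :: "'m \<Rightarrow> 'o"
  Idm :: "'o \<Rightarrow> 'm"
  Comp :: "'m \<Rightarrow> 'm \<Rightarrow> 'm"  (infixl "\<cdot>\<index>" 70)
  Cell :: "'c set"
  Dm :: "'c \<Rightarrow> 'm"
  Cd :: "'c \<Rightarrow> 'm"
  Idc :: "'m \<Rightarrow> 'c"
  VComp :: "'c \<Rightarrow> 'c \<Rightarrow> 'c"  (infixl "\<bullet>\<index>" 70)
  HComp :: "'c \<Rightarrow> 'c \<Rightarrow> 'c"  (infixl "\<star>\<index>" 70)

definition under_cat :: "('o, 'm, 'c) two_cat \<Rightarrow> ('o, 'm) cat" where
  "under_cat A = \<lparr>Ob = Obj A, Ar = Mor A, dom = Src A, cod = Tgt A, ide = Idm A, cmp = Comp A\<rparr>"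

definition vert_cat :: "('o, 'm, 'c) two_cat \<Rightarrow> ('m, 'c) cat" where
  "vert_cat A = \<lparr>Ob = Mor A, Ar = Cell A, dom = Dm A, cod = Cd A, ide = Idc A, cmp = VComp A\<rparr>"

definition horiz_cat :: "('o, 'm, 'c) two_cat \<Rightarrow> ('o, 'c) cat" where
  "horiz_cat A = \<lparr>Ob = Obj A, Ar = Cell A, dom = (\<lambda>a. Src A (Dm A a)), cod = (\<lambda>a. Tgt A (Dm A a)),
     ide = (\<lambda>x. Idc A (Idm A x)), cmp = HComp A\<rparr>"

locale two_category =
  fixes A :: "('o, 'm, 'c) two_cat" (structure)
  assumes under: "category (under_cat A)"
    and vert: "category (vert_cat A)"
    and horiz: "category (horiz_cat A)"
    and globular_src: "a \<in> Cell A \<Longrightarrow> Src A (Cd A a) = Src A (Dm A a)"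
    and globular_tgt: "a \<in> Cell A \<Longrightarrow> Tgt A (Cd A a) = Tgt A (Dm A a)"
    and Dm_HComp: "\<lbrakk>a \<in> Cell A; b \<in> Cell A; Tgt A (Dm A a) = Src A (Dm A b)\<rbrakk>
      \<Longrightarrow> Dm A (b \<star> a) = Dm A b \<cdot> Dm A a"
    and Cd_HComp: "\<lbrakk>a \<in> Cell A; b \<in> Cell A; Tgt A (Dm A a) = Src A (Dm A b)\<rbrakk>
      \<Longrightarrow> Cd A (b \<star> a) = Cd A b \<cdot> Cd A a"
    and HComp_Idc: "\<lbrakk>f \<in> Mor A; g \<in> Mor A; Tgt A f = Src A g\<rbrakk>
      \<Longrightarrow> Idc A g \<star> Idc A f = Idc A (g \<cdot> f)"
    and interchange: "\<lbrakk>a \<in> Cell A; b \<in> Cell A; c \<in> Cell A; d \<in> Cell A;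
        Cd A a = Dm A b; Cd A c = Dm A d; Tgt A (Dm A a) = Src A (Dm A c)\<rbrakk>
      \<Longrightarrow> (d \<bullet> c) \<star> (b \<bullet> a) = (d \<star> b) \<bullet> (c \<star> a)"

definition hom_cat :: "('o, 'm, 'c) two_cat \<Rightarrow> 'o \<Rightarrow> 'o \<Rightarrow> ('m, 'c) cat" where
  "hom_cat A X Y =
     \<lparr>Ob = {f \<in> Mor A. Src A f = X \<and> Tgt A f = Y},
      Ar = {a \<in> Cell A. Src A (Dm A a) = X \<and> Tgt A (Dm A a) = Y},
      dom = Dm A, cod = Cd A, ide = Idc A, cmp = VComp A\<rparr>"

definition two_terminal :: "('o, 'm, 'c) two_cat \<Rightarrow> 'o \<Rightarrow> bool" where
  "two_terminal B L \<longleftrightarrow>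
     L \<in> Obj B \<and> (\<forall>X\<in>Obj B. isomorphic_cats (hom_cat B X L) terminal_cat)"

definition locally_discrete :: "('o, 'a) cat \<Rightarrow> ('o, 'a, 'a) two_cat" where
  "locally_discrete C =
     \<lparr>Obj = Ob C, Mor = Ar C, Src = dom C, Tgt = cod C, Idm = ide C, Comp = cmp C,
      Cell = Ar C, Dm = (\<lambda>u. u), Cd = (\<lambda>u. u), Idc = (\<lambda>u. u), VComp = (\<lambda>_ u. u),
      HComp = cmp C\<rparr>"

section \<open>2-functors, 2-natural transformations, modifications\<close>

text \<open>All families are required to be extensional (equal to \<open>undefined\<close> outside the
  carrier), so that HOL equality of 2-functors, 2-natural transformations and modifications is
  the mathematical one.\<close>

record ('o, 'm, 'c, 'p, 'n, 'd) two_func =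
  fob :: "'o \<Rightarrow> 'p"
  fmor :: "'m \<Rightarrow> 'n"
  fcell :: "'c \<Rightarrow> 'd"

definition two_functor ::
    "('o, 'm, 'c) two_cat \<Rightarrow> ('p, 'n, 'd) two_cat \<Rightarrow> ('o, 'm, 'c, 'p, 'n, 'd) two_func \<Rightarrow> bool" where
  "two_functor I A F \<longleftrightarrow>
     fob F \<in> Obj I \<rightarrow>\<^sub>E Obj A \<and> fmor F \<in> Mor I \<rightarrow>\<^sub>E Mor A \<and> fcell F \<in> Cell I \<rightarrow>\<^sub>E Cell A \<and>
     (\<forall>u\<in>Mor I. Src A (fmor F u) = fob F (Src I u) \<and> Tgt A (fmor F u) = fob F (Tgt I u)) \<and>
     (\<forall>i\<in>Obj I. fmor F (Idm I i) = Idm A (fob F i)) \<and>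
     (\<forall>u\<in>Mor I. \<forall>v\<in>Mor I. Tgt I u = Src I v \<longrightarrow>
        fmor F (v \<cdot>\<^bsub>I\<^esub> u) = fmor F v \<cdot>\<^bsub>A\<^esub> fmor F u) \<and>
     (\<forall>a\<in>Cell I. Dm A (fcell F a) = fmor F (Dm I a) \<and> Cd A (fcell F a) = fmor F (Cd I a)) \<and>
     (\<forall>u\<in>Mor I. fcell F (Idc I u) = Idc A (fmor F u)) \<and>
     (\<forall>a\<in>Cell I. \<forall>b\<in>Cell I. Cd I a = Dm I b \<longrightarrow>
        fcell F (b \<bullet>\<^bsub>I\<^esub> a) = fcell F b \<bullet>\<^bsub>A\<^esub> fcell F a) \<and>
     (\<forall>a\<in>Cell I. \<forall>b\<in>Cell I. Tgt I (Dm I a) = Src I (Dm I b) \<longrightarrow>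
        fcell F (b \<star>\<^bsub>I\<^esub> a) = fcell F b \<star>\<^bsub>A\<^esub> fcell F a)"

definition two_natural ::
    "('o, 'm, 'c) two_cat \<Rightarrow> ('p, 'n, 'd) two_cat \<Rightarrow> ('o, 'm, 'c, 'p, 'n, 'd) two_func \<Rightarrow>
     ('o, 'm, 'c, 'p, 'n, 'd) two_func \<Rightarrow> ('o \<Rightarrow> 'n) \<Rightarrow> bool" where
  "two_natural I A F G \<mu> \<longleftrightarrow>
     \<mu> \<in> Obj I \<rightarrow>\<^sub>E Mor A \<and>
     (\<forall>i\<in>Obj I. Src A (\<mu> i) = fob F i \<and> Tgt A (\<mu> i) = fob G i) \<and>
     (\<forall>u\<in>Mor I. fmor G u \<cdot>\<^bsub>A\<^esub> \<mu> (Src I u) = \<mu> (Tgt I u) \<cdot>\<^bsub>A\<^esub> fmor F u) \<and>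
     (\<forall>a\<in>Cell I. fcell G a \<star>\<^bsub>A\<^esub> Idc A (\<mu> (Src I (Dm I a)))
                 = Idc A (\<mu> (Tgt I (Dm I a))) \<star>\<^bsub>A\<^esub> fcell F a)"

definition modification ::
    "('o, 'm, 'c) two_cat \<Rightarrow> ('p, 'n, 'd) two_cat \<Rightarrow> ('o, 'm, 'c, 'p, 'n, 'd) two_func \<Rightarrow>
     ('o, 'm, 'c, 'p, 'n, 'd) two_func \<Rightarrow> ('o \<Rightarrow> 'n) \<Rightarrow> ('o \<Rightarrow> 'n) \<Rightarrow> ('o \<Rightarrow> 'd) \<Rightarrow> bool" where
  "modification I A F G \<mu> \<nu> \<phi> \<longleftrightarrow>
     \<phi> \<in> Obj I \<rightarrow>\<^sub>E Cell A \<and>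
     (\<forall>i\<in>Obj I. Dm A (\<phi> i) = \<mu> i \<and> Cd A (\<phi> i) = \<nu> i) \<and>
     (\<forall>u\<in>Mor I. Idc A (fmor G u) \<star>\<^bsub>A\<^esub> \<phi> (Src I u) = \<phi> (Tgt I u) \<star>\<^bsub>A\<^esub> Idc A (fmor F u))"

text \<open>In the 2-category \<open>[I, A]\<close> a morphism \<open>(F, G, \<mu>)\<close> and a 2-morphism \<open>(m, n, \<phi>)\<close> carry their
  domain and codomain.\<close>

type_synonym ('o, 'm, 'c, 'p, 'n, 'd) nat_trans =
  "('o, 'm, 'c, 'p, 'n, 'd) two_func \<times> ('o, 'm, 'c, 'p, 'n, 'd) two_func \<times> ('o \<Rightarrow> 'n)"

type_synonym ('o, 'm, 'c, 'p, 'n, 'd) modif =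
  "('o, 'm, 'c, 'p, 'n, 'd) nat_trans \<times> ('o, 'm, 'c, 'p, 'n, 'd) nat_trans \<times> ('o \<Rightarrow> 'd)"

definition nt_comp ::
    "('o, 'm, 'c) two_cat \<Rightarrow> ('p, 'n, 'd) two_cat \<Rightarrow> ('o, 'm, 'c, 'p, 'n, 'd) nat_trans \<Rightarrow>
     ('o, 'm, 'c, 'p, 'n, 'd) nat_trans \<Rightarrow> ('o, 'm, 'c, 'p, 'n, 'd) nat_trans" where
  "nt_comp I A = (\<lambda>(G', H, \<nu>) (F, G, \<mu>). (F, H, \<lambda>i\<in>Obj I. \<nu> i \<cdot>\<^bsub>A\<^esub> \<mu> i))"

definition functor_2cat ::
    "('o, 'm, 'c) two_cat \<Rightarrow> ('p, 'n, 'd) two_cat \<Rightarrow>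
     (('o, 'm, 'c, 'p, 'n, 'd) two_func, ('o, 'm, 'c, 'p, 'n, 'd) nat_trans,
      ('o, 'm, 'c, 'p, 'n, 'd) modif) two_cat" where
  "functor_2cat I A =
     \<lparr>Obj = {F. two_functor I A F},
      Mor = {(F, G, \<mu>). two_functor I A F \<and> two_functor I A G \<and> two_natural I A F G \<mu>},
      Src = (\<lambda>(F, G, \<mu>). F),
      Tgt = (\<lambda>(F, G, \<mu>). G),
      Idm = (\<lambda>F. (F, F, \<lambda>i\<in>Obj I. Idm A (fob F i))),
      Comp = nt_comp I A,
      Cell = {((F, G, \<mu>), (F', G', \<nu>), \<phi>). F' = F \<and> G' = G \<and>
                two_functor I A F \<and> two_functor I A G \<and>
                two_natural I A F G \<mu> \<and> two_natural I A F G \<nu> \<and> modification I A F G \<mu> \<nu> \<phi>},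
      Dm = (\<lambda>(m, n, \<phi>). m),
      Cd = (\<lambda>(m, n, \<phi>). n),
      Idc = (\<lambda>(F, G, \<mu>). ((F, G, \<mu>), (F, G, \<mu>), \<lambda>i\<in>Obj I. Idc A (\<mu> i))),
      VComp = (\<lambda>(n', p, \<psi>) (m, n, \<phi>). (m, p, \<lambda>i\<in>Obj I. \<psi> i \<bullet>\<^bsub>A\<^esub> \<phi> i)),
      HComp = (\<lambda>(m', n', \<psi>) (m, n, \<phi>).
                 (nt_comp I A m' m, nt_comp I A n' n, \<lambda>i\<in>Obj I. \<psi> i \<star>\<^bsub>A\<^esub> \<phi> i))\<rparr>"

definition const_functor ::
    "('o, 'm, 'c) two_cat \<Rightarrow> ('p, 'n, 'd) two_cat \<Rightarrow> 'p \<Rightarrow> ('o, 'm, 'c, 'p, 'n, 'd) two_func" where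
  "const_functor I A X =
     \<lparr>fob = (\<lambda>i\<in>Obj I. X), fmor = (\<lambda>u\<in>Mor I. Idm A X), fcell = (\<lambda>a\<in>Cell I. Idc A (Idm A X))\<rparr>"

definition const_nat ::
    "('o, 'm, 'c) two_cat \<Rightarrow> ('p, 'n, 'd) two_cat \<Rightarrow> 'n \<Rightarrow> ('o, 'm, 'c, 'p, 'n, 'd) nat_trans" where
  "const_nat I A f = (const_functor I A (Src A f), const_functor I A (Tgt A f), \<lambda>i\<in>Obj I. f)"

definition const_modif ::
    "('o, 'm, 'c) two_cat \<Rightarrow> ('p, 'n, 'd) two_cat \<Rightarrow> 'd \<Rightarrow> ('o, 'm, 'c, 'p, 'n, 'd) modif" where
  "const_modif I A a = (const_nat I A (Dm A a), const_nat I A (Cd A a), \<lambda>i\<in>Obj I. a)"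

definition diag ::
    "('o, 'm, 'c) two_cat \<Rightarrow> ('p, 'n, 'd) two_cat \<Rightarrow>
     ('p, 'n, 'd, ('o, 'm, 'c, 'p, 'n, 'd) two_func, ('o, 'm, 'c, 'p, 'n, 'd) nat_trans,
      ('o, 'm, 'c, 'p, 'n, 'd) modif) two_func" where
  "diag I A = \<lparr>fob = (\<lambda>X\<in>Obj A. const_functor I A X), fmor = (\<lambda>f\<in>Mor A. const_nat I A f),
     fcell = (\<lambda>a\<in>Cell A. const_modif I A a)\<rparr>"

section \<open>2-limits and the lax slice\<close>

definition is_2cone ::
    "('o, 'm, 'c) two_cat \<Rightarrow> ('p, 'n, 'd) two_cat \<Rightarrow> ('o, 'm, 'c, 'p, 'n, 'd) two_func \<Rightarrow>
     'p \<Rightarrow> ('o, 'm, 'c, 'p, 'n, 'd) nat_trans \<Rightarrow> bool" where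
  "is_2cone I A F X \<mu> \<longleftrightarrow> X \<in> Obj A \<and>
     \<mu> \<in> Mor (functor_2cat I A) \<and>
     Src (functor_2cat I A) \<mu> = fob (diag I A) X \<and> Tgt (functor_2cat I A) \<mu> = F"

text \<open>The functor \<open>\<lambda>\<^sub>* \<circ> \<Delta>\<close>, sending \<open>f\<close> to \<open>\<lambda> \<Delta>f\<close> and \<open>\<alpha>\<close> to \<open>\<lambda> * \<Delta>\<alpha>\<close>.\<close>

definition postcomp_diag ::
    "('o, 'm, 'c) two_cat \<Rightarrow> ('p, 'n, 'd) two_cat \<Rightarrow> ('o, 'm, 'c, 'p, 'n, 'd) nat_trans \<Rightarrow>
     ('n, 'd, ('o, 'm, 'c, 'p, 'n, 'd) nat_trans, ('o, 'm, 'c, 'p, 'n, 'd) modif) func" where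
  "postcomp_diag I A \<mu> =
     \<lparr>on_ob = (\<lambda>f. \<mu> \<cdot>\<^bsub>functor_2cat I A\<^esub> fmor (diag I A) f),
      on_ar = (\<lambda>a. Idc (functor_2cat I A) \<mu> \<star>\<^bsub>functor_2cat I A\<^esub> fcell (diag I A) a)\<rparr>"

definition is_2limit ::
    "('o, 'm, 'c) two_cat \<Rightarrow> ('p, 'n, 'd) two_cat \<Rightarrow> ('o, 'm, 'c, 'p, 'n, 'd) two_func \<Rightarrow>
     'p \<times> ('o, 'm, 'c, 'p, 'n, 'd) nat_trans \<Rightarrow> bool" where
  "is_2limit I A F = (\<lambda>(L, \<mu>). is_2cone I A F L \<mu> \<and>
     (\<forall>X\<in>Obj A. is_iso_functor (hom_cat A X L) (hom_cat (functor_2cat I A) (fob (diag I A) X) F)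
        (postcomp_diag I A \<mu>)))"

text \<open>As in \<open>[I, A]\<close>, morphisms \<open>(x, y, f, \<phi>)\<close> and 2-morphisms \<open>(p, q, \<alpha>)\<close> of the lax slice carry
  their domain and codomain.\<close>

type_synonym ('o, 'm, 'c, 'p, 'n, 'd) slice_ob = "'p \<times> ('o, 'm, 'c, 'p, 'n, 'd) nat_trans"

type_synonym ('o, 'm, 'c, 'p, 'n, 'd) slice_mor =
  "('o, 'm, 'c, 'p, 'n, 'd) slice_ob \<times> ('o, 'm, 'c, 'p, 'n, 'd) slice_ob \<times> 'n \<times>
   ('o, 'm, 'c, 'p, 'n, 'd) modif"

type_synonym ('o, 'm, 'c, 'p, 'n, 'd) slice_cell =
  "('o, 'm, 'c, 'p, 'n, 'd) slice_mor \<times> ('o, 'm, 'c, 'p, 'n, 'd) slice_mor \<times> 'd"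

definition slice_obs ::
    "('o, 'm, 'c) two_cat \<Rightarrow> ('p, 'n, 'd) two_cat \<Rightarrow> ('o, 'm, 'c, 'p, 'n, 'd) two_func \<Rightarrow>
     ('o, 'm, 'c, 'p, 'n, 'd) slice_ob set" where
  "slice_obs I A F = {(X, \<mu>). is_2cone I A F X \<mu>}"

definition slice_mors ::
    "('o, 'm, 'c) two_cat \<Rightarrow> ('p, 'n, 'd) two_cat \<Rightarrow> ('o, 'm, 'c, 'p, 'n, 'd) two_func \<Rightarrow>
     ('o, 'm, 'c, 'p, 'n, 'd) slice_mor set" where
  "slice_mors I A F = {((X, \<mu>), (Y, \<nu>), f, \<phi>).
     (X, \<mu>) \<in> slice_obs I A F \<and> (Y, \<nu>) \<in> slice_obs I A F \<and>
     f \<in> Mor A \<and> Src A f = X \<and> Tgt A f = Y \<and>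
     \<phi> \<in> Cell (functor_2cat I A) \<and>
     Dm (functor_2cat I A) \<phi> = \<nu> \<cdot>\<^bsub>functor_2cat I A\<^esub> fmor (diag I A) f \<and>
     Cd (functor_2cat I A) \<phi> = \<mu>}"

definition slice_comp ::
    "('o, 'm, 'c) two_cat \<Rightarrow> ('p, 'n, 'd) two_cat \<Rightarrow> ('o, 'm, 'c, 'p, 'n, 'd) slice_mor \<Rightarrow>
     ('o, 'm, 'c, 'p, 'n, 'd) slice_mor \<Rightarrow> ('o, 'm, 'c, 'p, 'n, 'd) slice_mor" where
  "slice_comp I A = (\<lambda>(y', z, g, \<psi>) (x, y, f, \<phi>).
     (x, z, g \<cdot>\<^bsub>A\<^esub> f,
      \<phi> \<bullet>\<^bsub>functor_2cat I A\<^esub>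
        (\<psi> \<star>\<^bsub>functor_2cat I A\<^esub> Idc (functor_2cat I A) (fmor (diag I A) f))))"

definition lax_slice ::
    "('o, 'm, 'c) two_cat \<Rightarrow> ('p, 'n, 'd) two_cat \<Rightarrow> ('o, 'm, 'c, 'p, 'n, 'd) two_func \<Rightarrow>
     (('o, 'm, 'c, 'p, 'n, 'd) slice_ob, ('o, 'm, 'c, 'p, 'n, 'd) slice_mor,
      ('o, 'm, 'c, 'p, 'n, 'd) slice_cell) two_cat" where
  "lax_slice I A F =
     \<lparr>Obj = slice_obs I A F,
      Mor = slice_mors I A F,
      Src = (\<lambda>(x, y, f, \<phi>). x),
      Tgt = (\<lambda>(x, y, f, \<phi>). y),
      Idm = (\<lambda>(X, \<mu>). ((X, \<mu>), (X, \<mu>), Idm A X, Idc (functor_2cat I A) \<mu>)),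
      Comp = slice_comp I A,
      Cell = {((x, (Y, \<nu>), f, \<phi>), (x', y', g, \<psi>), \<alpha>). x' = x \<and> y' = (Y, \<nu>) \<and>
                (x, (Y, \<nu>), f, \<phi>) \<in> slice_mors I A F \<and> (x, (Y, \<nu>), g, \<psi>) \<in> slice_mors I A F \<and>
                \<alpha> \<in> Cell A \<and> Dm A \<alpha> = f \<and> Cd A \<alpha> = g \<and>
                \<psi> \<bullet>\<^bsub>functor_2cat I A\<^esub>
                  (Idc (functor_2cat I A) \<nu> \<star>\<^bsub>functor_2cat I A\<^esub> fcell (diag I A) \<alpha>) = \<phi>},
      Dm = (\<lambda>(p, q, \<alpha>). p),
      Cd = (\<lambda>(p, q, \<alpha>). q),
      Idc = (\<lambda>(x, y, f, \<phi>). ((x, y, f, \<phi>), (x, y, f, \<phi>), Idc A f)),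
      VComp = (\<lambda>(q', r, \<beta>) (p, q, \<alpha>). (p, r, \<beta> \<bullet>\<^bsub>A\<^esub> \<alpha>)),
      HComp = (\<lambda>(p', q', \<beta>) (p, q, \<alpha>). (slice_comp I A p' p, slice_comp I A q' q, \<beta> \<star>\<^bsub>A\<^esub> \<alpha>))\<rparr>"

section \<open>2-categories given by generators and relations\<close>

text \<open>Formal composites of generators, again in applicative order.\<close>

datatype ('o, 'm) term1 =
  Id1 'o
  | Gen1 'm
  | Comp1 "('o, 'm) term1" "('o, 'm) term1"

datatype ('o, 'm, 'c) term2 =
  Id2 "('o, 'm) term1"
  | Gen2 'c
  | VComp2 "('o, 'm, 'c) term2" "('o, 'm, 'c) term2"
  | HComp2 "('o, 'm, 'c) term2" "('o, 'm, 'c) term2"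

record ('o, 'm, 'c) presentation =
  gsrc :: "'m \<Rightarrow> 'o"
  gtgt :: "'m \<Rightarrow> 'o"
  gdom :: "'c \<Rightarrow> ('o, 'm) term1"
  gcod :: "'c \<Rightarrow> ('o, 'm) term1"
  rel1 :: "(('o, 'm) term1 \<times> ('o, 'm) term1) set"
  rel2 :: "(('o, 'm, 'c) term2 \<times> ('o, 'm, 'c) term2) set"

primrec src1 :: "('o, 'm, 'c) presentation \<Rightarrow> ('o, 'm) term1 \<Rightarrow> 'o" where
  "src1 P (Id1 x) = x"
| "src1 P (Gen1 m) = gsrc P m"
| "src1 P (Comp1 q p) = src1 P p"

primrec tgt1 :: "('o, 'm, 'c) presentation \<Rightarrow> ('o, 'm) term1 \<Rightarrow> 'o" where
  "tgt1 P (Id1 x) = x"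
| "tgt1 P (Gen1 m) = gtgt P m"
| "tgt1 P (Comp1 q p) = tgt1 P q"

primrec wf1 :: "('o, 'm, 'c) presentation \<Rightarrow> ('o, 'm) term1 \<Rightarrow> bool" where
  "wf1 P (Id1 x) \<longleftrightarrow> True"
| "wf1 P (Gen1 m) \<longleftrightarrow> True"
| "wf1 P (Comp1 q p) \<longleftrightarrow> wf1 P q \<and> wf1 P p \<and> tgt1 P p = src1 P q"

inductive eq1 :: "('o, 'm, 'c) presentation \<Rightarrow> ('o, 'm) term1 \<Rightarrow> ('o, 'm) term1 \<Rightarrow> bool"
  for P where
  eq1_refl: "wf1 P p \<Longrightarrow> eq1 P p p"
| eq1_sym: "eq1 P p q \<Longrightarrow> eq1 P q p"
| eq1_trans: "\<lbrakk>eq1 P p q; eq1 P q r\<rbrakk> \<Longrightarrow> eq1 P p r"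
| eq1_rel: "(p, q) \<in> rel1 P \<Longrightarrow> eq1 P p q"
| eq1_comp: "\<lbrakk>eq1 P p p'; eq1 P q q'; wf1 P (Comp1 q p)\<rbrakk> \<Longrightarrow> eq1 P (Comp1 q p) (Comp1 q' p')"
| eq1_idl: "wf1 P p \<Longrightarrow> eq1 P (Comp1 (Id1 (tgt1 P p)) p) p"
| eq1_idr: "wf1 P p \<Longrightarrow> eq1 P (Comp1 p (Id1 (src1 P p))) p"
| eq1_assoc: "wf1 P (Comp1 r (Comp1 q p)) \<Longrightarrow> eq1 P (Comp1 r (Comp1 q p)) (Comp1 (Comp1 r q) p)"

primrec dom2 :: "('o, 'm, 'c) presentation \<Rightarrow> ('o, 'm, 'c) term2 \<Rightarrow> ('o, 'm) term1" where
  "dom2 P (Id2 p) = p"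
| "dom2 P (Gen2 c) = gdom P c"
| "dom2 P (VComp2 t s) = dom2 P s"
| "dom2 P (HComp2 t s) = Comp1 (dom2 P t) (dom2 P s)"

primrec cod2 :: "('o, 'm, 'c) presentation \<Rightarrow> ('o, 'm, 'c) term2 \<Rightarrow> ('o, 'm) term1" where
  "cod2 P (Id2 p) = p"
| "cod2 P (Gen2 c) = gcod P c"
| "cod2 P (VComp2 t s) = cod2 P t"
| "cod2 P (HComp2 t s) = Comp1 (cod2 P t) (cod2 P s)"

text \<open>Vertical composability is tested modulo the equations between formal morphisms.\<close>

primrec wf2 :: "('o, 'm, 'c) presentation \<Rightarrow> ('o, 'm, 'c) term2 \<Rightarrow> bool" where
  "wf2 P (Id2 p) \<longleftrightarrow> wf1 P p"
| "wf2 P (Gen2 c) \<longleftrightarrow> True"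
| "wf2 P (VComp2 t s) \<longleftrightarrow> wf2 P t \<and> wf2 P s \<and> eq1 P (cod2 P s) (dom2 P t)"
| "wf2 P (HComp2 t s) \<longleftrightarrow> wf2 P t \<and> wf2 P s \<and> tgt1 P (dom2 P s) = src1 P (dom2 P t)"

inductive eq2 :: "('o, 'm, 'c) presentation \<Rightarrow> ('o, 'm, 'c) term2 \<Rightarrow> ('o, 'm, 'c) term2 \<Rightarrow> bool"
  for P where
  eq2_refl: "wf2 P s \<Longrightarrow> eq2 P s s"
| eq2_sym: "eq2 P s t \<Longrightarrow> eq2 P t s"
| eq2_trans: "\<lbrakk>eq2 P s t; eq2 P t u\<rbrakk> \<Longrightarrow> eq2 P s u"
| eq2_rel: "(s, t) \<in> rel2 P \<Longrightarrow> eq2 P s t"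
| eq2_id: "eq1 P p q \<Longrightarrow> eq2 P (Id2 p) (Id2 q)"
| eq2_vcomp: "\<lbrakk>eq2 P s s'; eq2 P t t'; wf2 P (VComp2 t s)\<rbrakk> \<Longrightarrow> eq2 P (VComp2 t s) (VComp2 t' s')"
| eq2_hcomp: "\<lbrakk>eq2 P s s'; eq2 P t t'; wf2 P (HComp2 t s)\<rbrakk> \<Longrightarrow> eq2 P (HComp2 t s) (HComp2 t' s')"
| eq2_vidl: "wf2 P s \<Longrightarrow> eq2 P (VComp2 (Id2 (cod2 P s)) s) s"
| eq2_vidr: "wf2 P s \<Longrightarrow> eq2 P (VComp2 s (Id2 (dom2 P s))) s"
| eq2_vassoc: "wf2 P (VComp2 u (VComp2 t s)) \<Longrightarrow>
    eq2 P (VComp2 u (VComp2 t s)) (VComp2 (VComp2 u t) s)"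
| eq2_hidl: "wf2 P s \<Longrightarrow> eq2 P (HComp2 (Id2 (Id1 (tgt1 P (dom2 P s)))) s) s"
| eq2_hidr: "wf2 P s \<Longrightarrow> eq2 P (HComp2 s (Id2 (Id1 (src1 P (dom2 P s))))) s"
| eq2_hassoc: "wf2 P (HComp2 u (HComp2 t s)) \<Longrightarrow>
    eq2 P (HComp2 u (HComp2 t s)) (HComp2 (HComp2 u t) s)"
| eq2_hid: "wf1 P (Comp1 q p) \<Longrightarrow> eq2 P (HComp2 (Id2 q) (Id2 p)) (Id2 (Comp1 q p))"
| eq2_interchange: "\<lbrakk>wf2 P (VComp2 t s); wf2 P (VComp2 t' s'); wf2 P (HComp2 s' s)\<rbrakk> \<Longrightarrow>
    eq2 P (HComp2 (VComp2 t' s') (VComp2 t s)) (VComp2 (HComp2 t' t) (HComp2 s' s))"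

definition cls1 :: "('o, 'm, 'c) presentation \<Rightarrow> ('o, 'm) term1 \<Rightarrow> ('o, 'm) term1 set" where
  "cls1 P p = {q. eq1 P p q}"

definition cls2 :: "('o, 'm, 'c) presentation \<Rightarrow> ('o, 'm, 'c) term2 \<Rightarrow> ('o, 'm, 'c) term2 set" where
  "cls2 P s = {t. eq2 P s t}"

definition rep :: "'a set \<Rightarrow> 'a" where
  "rep c = (SOME x. x \<in> c)"

text \<open>Every element of the types \<open>'o\<close>, \<open>'m\<close>, \<open>'c\<close> is a generator.\<close>

definition presented_2cat :: "('o, 'm, 'c) presentation \<Rightarrow>
    ('o, ('o, 'm) term1 set, ('o, 'm, 'c) term2 set) two_cat" where
  "presented_2cat P =
     \<lparr>Obj = UNIV,
      Mor = {cls1 P p | p. wf1 P p},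
      Src = (\<lambda>m. src1 P (rep m)),
      Tgt = (\<lambda>m. tgt1 P (rep m)),
      Idm = (\<lambda>x. cls1 P (Id1 x)),
      Comp = (\<lambda>n m. cls1 P (Comp1 (rep n) (rep m))),
      Cell = {cls2 P s | s. wf2 P s},
      Dm = (\<lambda>a. cls1 P (dom2 P (rep a))),
      Cd = (\<lambda>a. cls1 P (cod2 P (rep a))),
      Idc = (\<lambda>m. cls2 P (Id2 (rep m))),
      VComp = (\<lambda>b a. cls2 P (VComp2 (rep b) (rep a))),
      HComp = (\<lambda>b a. cls2 P (HComp2 (rep b) (rep a)))\<rparr>"

text \<open>Generating 2-morphisms and relations must be between parallel terms.\<close>

definition valid_presentation :: "('o, 'm, 'c) presentation \<Rightarrow> bool" where
  "valid_presentation P \<longleftrightarrow>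
     (\<forall>c. wf1 P (gdom P c) \<and> wf1 P (gcod P c) \<and>
        src1 P (gdom P c) = src1 P (gcod P c) \<and> tgt1 P (gdom P c) = tgt1 P (gcod P c)) \<and>
     (\<forall>(p, q) \<in> rel1 P. wf1 P p \<and> wf1 P q \<and> src1 P p = src1 P q \<and> tgt1 P p = tgt1 P q) \<and>
     (\<forall>(s, t) \<in> rel2 P. wf2 P s \<and> wf2 P t \<and>
        eq1 P (dom2 P s) (dom2 P t) \<and> eq1 P (cod2 P s) (cod2 P t))"

section \<open>The pullback shape and the example\<close>

datatype cospan_ob = Lft | Apex | Rgt

datatype cospan_ar = CId cospan_ob | LftArr | RgtArr

fun cospan_cmp :: "cospan_ar \<Rightarrow> cospan_ar \<Rightarrow> cospan_ar" where
  "cospan_cmp (CId x) u = u"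
| "cospan_cmp LftArr u = LftArr"
| "cospan_cmp RgtArr u = RgtArr"

definition cospan_cat :: "(cospan_ob, cospan_ar) cat" where
  "cospan_cat =
     \<lparr>Ob = UNIV, Ar = UNIV,
      dom = (\<lambda>u. case u of CId x \<Rightarrow> x | LftArr \<Rightarrow> Lft | RgtArr \<Rightarrow> Rgt),
      cod = (\<lambda>u. case u of CId x \<Rightarrow> x | LftArr \<Rightarrow> Apex | RgtArr \<Rightarrow> Apex),
      ide = CId, cmp = cospan_cmp\<rparr>"

definition pullback_shape :: "(cospan_ob, cospan_ar, cospan_ar) two_cat" where
  "pullback_shape = locally_discrete cospan_cat"

datatype ex_ob = oX | oL | oA | oB | oC

datatype ex_mor = mf | mlam0 | mlam1 | malpha0 | malpha1 | mb | mc

datatype ex_cell = gamma0 | gamma1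

primrec ex_src :: "ex_mor \<Rightarrow> ex_ob" where
  "ex_src mf = oX" | "ex_src mlam0 = oL" | "ex_src mlam1 = oL" | "ex_src malpha0 = oX"
| "ex_src malpha1 = oX" | "ex_src mb = oB" | "ex_src mc = oC"

primrec ex_tgt :: "ex_mor \<Rightarrow> ex_ob" where
  "ex_tgt mf = oL" | "ex_tgt mlam0 = oB" | "ex_tgt mlam1 = oC" | "ex_tgt malpha0 = oB"
| "ex_tgt malpha1 = oC" | "ex_tgt mb = oA" | "ex_tgt mc = oA"

primrec ex_dom :: "ex_cell \<Rightarrow> (ex_ob, ex_mor) term1" where
  "ex_dom gamma0 = Comp1 (Gen1 mlam0) (Gen1 mf)"
| "ex_dom gamma1 = Comp1 (Gen1 mlam1) (Gen1 mf)"

primrec ex_cod :: "ex_cell \<Rightarrow> (ex_ob, ex_mor) term1" where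
  "ex_cod gamma0 = Gen1 malpha0"
| "ex_cod gamma1 = Gen1 malpha1"

text \<open>Besides \<open>b \<lambda>\<^sub>0 = c \<lambda>\<^sub>1\<close> and \<open>b \<alpha>\<^sub>0 = c \<alpha>\<^sub>1\<close> the relation \<open>b * \<gamma>\<^sub>0 = c * \<gamma>\<^sub>1\<close> is imposed.  It is
  what makes \<open>(\<gamma>\<^sub>0, \<gamma>\<^sub>1)\<close> a modification; without it there is no morphism
  \<open>(X, \<alpha>) \<rightarrow> (L, \<lambda>)\<close> in the lax slice and \<open>(L, \<lambda>)\<close> is not 2-terminal.\<close>

definition ex_pres :: "(ex_ob, ex_mor, ex_cell) presentation" where
  "ex_pres =
     \<lparr>gsrc = ex_src, gtgt = ex_tgt, gdom = ex_dom, gcod = ex_cod,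
      rel1 = {(Comp1 (Gen1 mb) (Gen1 mlam0), Comp1 (Gen1 mc) (Gen1 mlam1)),
              (Comp1 (Gen1 mb) (Gen1 malpha0), Comp1 (Gen1 mc) (Gen1 malpha1))},
      rel2 = {(HComp2 (Id2 (Gen1 mb)) (Gen2 gamma0), HComp2 (Id2 (Gen1 mc)) (Gen2 gamma1))}\<rparr>"

type_synonym ex_1cell = "(ex_ob, ex_mor) term1 set"

type_synonym ex_2cell = "(ex_ob, ex_mor, ex_cell) term2 set"

definition ex_cat :: "(ex_ob, ex_1cell, ex_2cell) two_cat" where
  "ex_cat = presented_2cat ex_pres"

definition ex_gen :: "ex_mor \<Rightarrow> ex_1cell" where
  "ex_gen m = cls1 ex_pres (Gen1 m)"

primrec ex_F_ob :: "cospan_ob \<Rightarrow> ex_ob" where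
  "ex_F_ob Lft = oB" | "ex_F_ob Apex = oA" | "ex_F_ob Rgt = oC"

primrec ex_F_ar :: "cospan_ar \<Rightarrow> ex_1cell" where
  "ex_F_ar (CId x) = Idm ex_cat (ex_F_ob x)"
| "ex_F_ar LftArr = ex_gen mb"
| "ex_F_ar RgtArr = ex_gen mc"

definition ex_F ::
    "(cospan_ob, cospan_ar, cospan_ar, ex_ob, ex_1cell, ex_2cell) two_func" where
  "ex_F = \<lparr>fob = ex_F_ob, fmor = ex_F_ar, fcell = (\<lambda>u. Idc ex_cat (ex_F_ar u))\<rparr>"

primrec ex_lam_comp :: "cospan_ob \<Rightarrow> ex_1cell" where
  "ex_lam_comp Lft = ex_gen mlam0"
| "ex_lam_comp Apex = ex_gen mb \<cdot>\<^bsub>ex_cat\<^esub> ex_gen mlam0"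
| "ex_lam_comp Rgt = ex_gen mlam1"

definition ex_lam ::
    "(cospan_ob, cospan_ar, cospan_ar, ex_ob, ex_1cell, ex_2cell) nat_trans" where
  "ex_lam = (fob (diag pullback_shape ex_cat) oL, ex_F, ex_lam_comp)"

section \<open>The data of the example are well-formed\<close>

lemma eq1_wf:
  assumes "valid_presentation P" "eq1 P p q"
  shows "wf1 P p \<and> wf1 P q \<and> src1 P p = src1 P q \<and> tgt1 P p = tgt1 P q"
  using assms(2) by induction (use assms(1) in \<open>auto simp: valid_presentation_def\<close>)

lemma wf2_bd:
  assumes "valid_presentation P" "wf2 P s"
  shows "wf1 P (dom2 P s) \<and> wf1 P (cod2 P s) \<and> src1 P (dom2 P s) = src1 P (cod2 P s)
    \<and> tgt1 P (dom2 P s) = tgt1 P (cod2 P s)"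
  using assms(2)
proof (induction s)
  case (Gen2 x) then show ?case using assms(1) by (simp add: valid_presentation_def)
next
  case (VComp2 t s) then show ?case using eq1_wf[OF assms(1), of "cod2 P s" "dom2 P t"] by simp
qed auto

lemma eq2_wf:
  assumes V: "valid_presentation P" and "eq2 P s t"
  shows "wf2 P s \<and> wf2 P t \<and> eq1 P (dom2 P s) (dom2 P t) \<and> eq1 P (cod2 P s) (cod2 P t)"
  using assms(2)
proof induction
  case (eq2_rel s t) then show ?case using V by (auto simp: valid_presentation_def)
next
  case (eq2_id p q) then show ?case using eq1_wf[OF V] by auto
next
  case (eq2_vcomp s s' t t')
  then show ?case using V by (auto intro: eq1_sym eq1_trans)
next
  case (eq2_hcomp s s' t t')
  then show ?case using wf2_bd[OF V, of s] wf2_bd[OF V, of t] eq1_wf[OF V, of "dom2 P s" "dom2 P s'"] eq1_wf[OF V, of "dom2 P t" "dom2 P t'"]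
    by (auto intro!: eq1_comp)
next
  case (eq2_vidl s) then show ?case using wf2_bd[OF V, of s] by (auto intro: eq1_refl)
next
  case (eq2_vidr s) then show ?case using wf2_bd[OF V, of s] by (auto intro: eq1_refl)
next
  case (eq2_vassoc u t s) then show ?case using wf2_bd[OF V] by (auto intro: eq1_refl)
next
  case (eq2_hidl s) then show ?case using wf2_bd[OF V, of s] eq1_idl[of P "dom2 P s"] eq1_idl[of P "cod2 P s"] by auto
next
  case (eq2_hidr s) then show ?case using wf2_bd[OF V, of s] eq1_idr[of P "dom2 P s"] eq1_idr[of P "cod2 P s"] by auto
next
  case (eq2_hassoc u t s) then show ?case using wf2_bd[OF V, of s] wf2_bd[OF V, of t] wf2_bd[OF V, of u] by (auto intro!: eq1_assoc)
next
  case (eq2_interchange t s t' s')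
  then show ?case using wf2_bd[OF V, of s] wf2_bd[OF V, of t]  wf2_bd[OF V, of s'] wf2_bd[OF V, of t']
    eq1_wf[OF V, of "cod2 P s" "dom2 P t"] eq1_wf[OF V, of "cod2 P s'" "dom2 P t'"]
    by (auto intro!: eq1_refl eq1_comp)
next
  case (eq2_refl s) then show ?case using wf2_bd[OF V, of s] by (auto intro: eq1_refl)
qed (auto intro: eq1_sym eq1_trans eq1_refl)

lemma cls1_eq: "eq1 P p q \<Longrightarrow> cls1 P p = cls1 P q"
  unfolding cls1_def by (auto intro: eq1_sym eq1_trans)
lemma cls2_eq: "eq2 P p q \<Longrightarrow> cls2 P p = cls2 P q"
  unfolding cls2_def by (auto intro: eq2_sym eq2_trans)
lemma rep1: "wf1 P p \<Longrightarrow> eq1 P p (rep (cls1 P p))"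
  unfolding rep_def cls1_def by (rule someI2[of _ p]) (auto intro: eq1_refl)
lemma rep2: "wf2 P p \<Longrightarrow> eq2 P p (rep (cls2 P p))"
  unfolding rep_def cls2_def by (rule someI2[of _ p]) (auto intro: eq2_refl)
lemma cls1_iff: "wf1 P p \<Longrightarrow> wf1 P q \<Longrightarrow> cls1 P p = cls1 P q \<longleftrightarrow> eq1 P p q"
  using cls1_eq[of P p q] eq1_refl[of P q] unfolding cls1_def by auto
lemma cls2_iff: "wf2 P p \<Longrightarrow> wf2 P q \<Longrightarrow> cls2 P p = cls2 P q \<longleftrightarrow> eq2 P p q"
  using cls2_eq[of P p q] eq2_refl[of P q] unfolding cls2_def by auto

context fixes P :: "('o,'m,'c) presentation" assumes V: "valid_presentation P"
begin
lemma p_src: "wf1 P p \<Longrightarrow> Src (presented_2cat P) (cls1 P p) = src1 P p"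
  using eq1_wf[OF V rep1[of P p]] by (simp add: presented_2cat_def)
lemma p_tgt: "wf1 P p \<Longrightarrow> Tgt (presented_2cat P) (cls1 P p) = tgt1 P p"
  using eq1_wf[OF V rep1[of P p]] by (simp add: presented_2cat_def)
lemma p_comp: "wf1 P p \<Longrightarrow> wf1 P q \<Longrightarrow> tgt1 P p = src1 P q \<Longrightarrow>
   Comp (presented_2cat P) (cls1 P q) (cls1 P p) = cls1 P (Comp1 q p)"
  using rep1[of P p] rep1[of P q] by (auto simp: presented_2cat_def intro!: cls1_eq[THEN sym] eq1_comp)
lemma p_idm: "Idm (presented_2cat P) x = cls1 P (Id1 x)" by (simp add: presented_2cat_def)
lemma p_dm: "wf2 P s \<Longrightarrow> Dm (presented_2cat P) (cls2 P s) = cls1 P (dom2 P s)"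
  using eq2_wf[OF V rep2[of P s]] by (auto simp: presented_2cat_def intro!: cls1_eq[THEN sym])
lemma p_cd: "wf2 P s \<Longrightarrow> Cd (presented_2cat P) (cls2 P s) = cls1 P (cod2 P s)"
  using eq2_wf[OF V rep2[of P s]] by (auto simp: presented_2cat_def intro!: cls1_eq[THEN sym])
lemma p_idc: "wf1 P p \<Longrightarrow> Idc (presented_2cat P) (cls1 P p) = cls2 P (Id2 p)"
  using rep1[of P p] by (auto simp: presented_2cat_def intro!: cls2_eq[THEN sym] eq2_id)
lemma p_vcomp: "wf2 P (VComp2 t s) \<Longrightarrow>
   VComp (presented_2cat P) (cls2 P t) (cls2 P s) = cls2 P (VComp2 t s)"
  using rep2[of P s] rep2[of P t] by (auto simp: presented_2cat_def intro!: cls2_eq[THEN sym] eq2_vcomp)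
lemma p_hcomp: "wf2 P (HComp2 t s) \<Longrightarrow>
   HComp (presented_2cat P) (cls2 P t) (cls2 P s) = cls2 P (HComp2 t s)"
  using rep2[of P s] rep2[of P t] by (auto simp: presented_2cat_def intro!: cls2_eq[THEN sym] eq2_hcomp)
lemma p_mor: "m \<in> Mor (presented_2cat P) \<longleftrightarrow> (\<exists>p. wf1 P p \<and> m = cls1 P p)" by (auto simp: presented_2cat_def)
lemma p_cell: "m \<in> Cell (presented_2cat P) \<longleftrightarrow> (\<exists>p. wf2 P p \<and> m = cls2 P p)" by (auto simp: presented_2cat_def)
lemma p_obj: "x \<in> Obj (presented_2cat P)" by (auto simp: presented_2cat_def)

lemmas p_simps = p_src p_tgt p_comp p_idm p_dm p_cd p_idc p_vcomp p_hcomp p_obj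

lemma p_morI: "wf1 P p \<Longrightarrow> cls1 P p \<in> Mor (presented_2cat P)" by (auto simp: p_mor)
lemma p_cellI: "wf2 P p \<Longrightarrow> cls2 P p \<in> Cell (presented_2cat P)" by (auto simp: p_cell)
lemma p_morE: "m \<in> Mor (presented_2cat P) \<Longrightarrow> (\<And>p. wf1 P p \<Longrightarrow> m = cls1 P p \<Longrightarrow> thesis) \<Longrightarrow> thesis" by (auto simp: p_mor)
lemma p_cellE: "m \<in> Cell (presented_2cat P) \<Longrightarrow> (\<And>p. wf2 P p \<Longrightarrow> m = cls2 P p \<Longrightarrow> thesis) \<Longrightarrow> thesis" by (auto simp: p_cell)
lemma wf2_bds: assumes "wf2 P s" shows "wf1 P (dom2 P s)" "wf1 P (cod2 P s)" "src1 P (cod2 P s) = src1 P (dom2 P s)"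
    "tgt1 P (cod2 P s) = tgt1 P (dom2 P s)"
  using wf2_bd[OF V assms] by auto
lemma eq1_ends: assumes "eq1 P s t" shows "src1 P t = src1 P s" "tgt1 P t = tgt1 P s"
  using eq1_wf[OF V assms] by auto

lemma presented_two_category: "two_category (presented_2cat P)"
proof (intro two_category.intro)
  show "category (under_cat (presented_2cat P))"
    by (rule category.intro; auto simp: under_cat_def p_simps cls1_iff intro!: p_morI eq1_idl eq1_idr eq1_assoc elim!: p_morE del: equalityI)
  show "category (vert_cat (presented_2cat P))"
    by (rule category.intro; auto simp: vert_cat_def p_simps wf2_bds cls1_iff cls2_iff eq1_refl intro!: p_morI p_cellI eq2_vidl eq2_vidr eq2_vassoc elim!: p_morE p_cellE del: equalityI)
  show "category (horiz_cat (presented_2cat P))"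
    by (rule category.intro; auto simp: horiz_cat_def p_simps wf2_bds cls1_iff cls2_iff eq1_refl intro!: p_morI p_cellI eq2_hidl eq2_hidr eq2_hassoc elim!: p_morE p_cellE del: equalityI)
  show "\<And>f g. \<lbrakk>f \<in> Mor (presented_2cat P); g \<in> Mor (presented_2cat P);
            Tgt (presented_2cat P) f = Src (presented_2cat P) g\<rbrakk>
           \<Longrightarrow> Idc (presented_2cat P) g \<star>\<^bsub>presented_2cat P\<^esub> Idc (presented_2cat P) f =
               Idc (presented_2cat P) (g \<cdot>\<^bsub>presented_2cat P\<^esub> f)"
    by (erule p_morE)+ (auto simp: p_simps intro!: cls2_eq eq2_hid del: equalityI)
  show "(d \<bullet>\<^bsub>presented_2cat P\<^esub> c) \<star>\<^bsub>presented_2cat P\<^esub> (b \<bullet>\<^bsub>presented_2cat P\<^esub> a) =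
               (d \<star>\<^bsub>presented_2cat P\<^esub> b) \<bullet>\<^bsub>presented_2cat P\<^esub> (c \<star>\<^bsub>presented_2cat P\<^esub> a)"
     if h: "a \<in> Cell (presented_2cat P)" "b \<in> Cell (presented_2cat P)"
           "c \<in> Cell (presented_2cat P)" "d \<in> Cell (presented_2cat P)"
           "Cd (presented_2cat P) a = Dm (presented_2cat P) b"
           "Cd (presented_2cat P) c = Dm (presented_2cat P) d"
           "Tgt (presented_2cat P) (Dm (presented_2cat P) a) = Src (presented_2cat P) (Dm (presented_2cat P) c)" for a b c d
  proof -
    obtain s t s' t' where w: "wf2 P s" "wf2 P t" "wf2 P s'" "wf2 P t'" and e: "a = cls2 P s" "b = cls2 P t" "c = cls2 P s'" "d = cls2 P t'"
      using h(1-4) by (elim p_cellE) 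
    have q: "eq1 P (cod2 P s) (dom2 P t)" "eq1 P (cod2 P s') (dom2 P t')" "tgt1 P (dom2 P s) = src1 P (dom2 P s')"
      using h(5-7) w by (auto simp: e p_simps wf2_bds cls1_iff)
    have q2: "tgt1 P (dom2 P t) = src1 P (dom2 P t')" "eq1 P (Comp1 (cod2 P s') (cod2 P s)) (Comp1 (dom2 P t') (dom2 P t))"
      using w q eq1_ends[OF q(1)] eq1_ends[OF q(2)] by (auto simp: wf2_bds intro!: eq1_comp)
    show ?thesis using w q q2 by (simp add: e p_simps cls2_iff) (rule eq2_interchange, auto)
  qed
qed (auto simp: p_simps wf2_bds elim!: p_cellE)

end

lemma ex_valid: "valid_presentation ex_pres"
proof -
  have "\<forall>c. wf1 ex_pres (ex_dom c) \<and> wf1 ex_pres (ex_cod c) \<and>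
        src1 ex_pres (ex_dom c) = src1 ex_pres (ex_cod c) \<and> tgt1 ex_pres (ex_dom c) = tgt1 ex_pres (ex_cod c)"
  proof
    fix c show "wf1 ex_pres (ex_dom c) \<and> wf1 ex_pres (ex_cod c) \<and>
        src1 ex_pres (ex_dom c) = src1 ex_pres (ex_cod c) \<and> tgt1 ex_pres (ex_dom c) = tgt1 ex_pres (ex_cod c)"
      by (cases c) (auto simp: ex_pres_def)
  qed
  moreover have r: "eq1 ex_pres (Comp1 (Gen1 mb) (Gen1 mlam0)) (Comp1 (Gen1 mc) (Gen1 mlam1))"
     "eq1 ex_pres (Comp1 (Gen1 mb) (Gen1 malpha0)) (Comp1 (Gen1 mc) (Gen1 malpha1))"
    by (rule eq1_rel, simp add: ex_pres_def)+
  moreover have "eq1 ex_pres (Comp1 (Gen1 mb) (Comp1 (Gen1 mlam0) (Gen1 mf))) (Comp1 (Gen1 mc) (Comp1 (Gen1 mlam1) (Gen1 mf)))"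
  proof -
    have "eq1 ex_pres (Comp1 (Gen1 mb) (Comp1 (Gen1 mlam0) (Gen1 mf))) (Comp1 (Comp1 (Gen1 mb) (Gen1 mlam0)) (Gen1 mf))"
      by (rule eq1_assoc) (simp add: ex_pres_def)
    moreover have "eq1 ex_pres (Comp1 (Comp1 (Gen1 mb) (Gen1 mlam0)) (Gen1 mf)) (Comp1 (Comp1 (Gen1 mc) (Gen1 mlam1)) (Gen1 mf))"
      by (rule eq1_comp[OF eq1_refl r(1)]) (simp_all add: ex_pres_def)
    moreover have "eq1 ex_pres (Comp1 (Gen1 mc) (Comp1 (Gen1 mlam1) (Gen1 mf))) (Comp1 (Comp1 (Gen1 mc) (Gen1 mlam1)) (Gen1 mf))"
      by (rule eq1_assoc) (simp add: ex_pres_def)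
    ultimately show ?thesis by (blast intro: eq1_trans eq1_sym)
  qed
  ultimately show ?thesis unfolding valid_presentation_def
    by (auto simp: ex_pres_def)
qed

lemma ex_two_category: "two_category ex_cat" unfolding ex_cat_def by (rule presented_two_category[OF ex_valid])

lemma shape_two_category: "two_category pullback_shape"
  unfolding pullback_shape_def locally_discrete_def cospan_cat_def
  by (intro two_category.intro category.intro; simp add: under_cat_def vert_cat_def horiz_cat_def split: cospan_ar.splits;
     elim cospan_cmp.elims; auto split: cospan_ar.splits)

context two_category begin
lemmas under_facts = under[unfolded category_def under_cat_def, simplified]
lemmas vert_facts = vert[unfolded category_def vert_cat_def, simplified]
lemmas horiz_facts = horiz[unfolded category_def horiz_cat_def, simplified]
lemma Mor_in[simp,intro]: "f \<in> Mor A \<Longrightarrow> Src A f \<in> Obj A" "f \<in> Mor A \<Longrightarrow> Tgt A f \<in> Obj A" "x \<in> Obj A \<Longrightarrow> Idm A x \<in> Mor A"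
  "x \<in> Obj A \<Longrightarrow> Src A (Idm A x) = x"  "x \<in> Obj A \<Longrightarrow> Tgt A (Idm A x) = x" using under_facts by auto
lemma Comp_in[simp]: "\<lbrakk>f \<in> Mor A; g \<in> Mor A; Tgt A f = Src A g\<rbrakk> \<Longrightarrow> g \<cdot> f \<in> Mor A"
  "\<lbrakk>f \<in> Mor A; g \<in> Mor A; Tgt A f = Src A g\<rbrakk> \<Longrightarrow> Src A (g \<cdot> f) = Src A f"
  "\<lbrakk>f \<in> Mor A; g \<in> Mor A; Tgt A f = Src A g\<rbrakk> \<Longrightarrow> Tgt A (g \<cdot> f) = Tgt A g" using under_facts by auto
lemma Comp_Idm[simp]: "f \<in> Mor A \<Longrightarrow> Tgt A f = x \<Longrightarrow> Idm A x \<cdot> f = f" "f \<in> Mor A \<Longrightarrow> Src A f = x \<Longrightarrow> f \<cdot> Idm A x = f"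
  using under_facts by auto
lemma Comp_assoc: "\<lbrakk>f \<in> Mor A; g \<in> Mor A; k \<in> Mor A; Tgt A f = Src A g; Tgt A g = Src A k\<rbrakk> \<Longrightarrow> (k \<cdot> g) \<cdot> f = k \<cdot> (g \<cdot> f)"
  using under_facts by auto
lemma Cell_in[simp,intro]: "f \<in> Cell A \<Longrightarrow> Dm A f \<in> Mor A" "f \<in> Cell A \<Longrightarrow> Cd A f \<in> Mor A" "x \<in> Mor A \<Longrightarrow> Idc A x \<in> Cell A"
  "x \<in> Mor A \<Longrightarrow> Dm A (Idc A x) = x"  "x \<in> Mor A \<Longrightarrow> Cd A (Idc A x) = x" using vert_facts by auto
lemma VComp_in[simp]: "\<lbrakk>f \<in> Cell A; g \<in> Cell A; Cd A f = Dm A g\<rbrakk> \<Longrightarrow> g \<bullet> f \<in> Cell A"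
  "\<lbrakk>f \<in> Cell A; g \<in> Cell A; Cd A f = Dm A g\<rbrakk> \<Longrightarrow> Dm A (g \<bullet> f) = Dm A f"
  "\<lbrakk>f \<in> Cell A; g \<in> Cell A; Cd A f = Dm A g\<rbrakk> \<Longrightarrow> Cd A (g \<bullet> f) = Cd A g" using vert_facts by auto
lemma VComp_Idc[simp]: "f \<in> Cell A \<Longrightarrow> Cd A f = x \<Longrightarrow> Idc A x \<bullet> f = f" "f \<in> Cell A \<Longrightarrow> Dm A f = x \<Longrightarrow> f \<bullet> Idc A x = f"
  using vert_facts by auto
lemma VComp_assoc: "\<lbrakk>f \<in> Cell A; g \<in> Cell A; k \<in> Cell A; Cd A f = Dm A g; Cd A g = Dm A k\<rbrakk> \<Longrightarrow> (k \<bullet> g) \<bullet> f = k \<bullet> (g \<bullet> f)"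
  using vert_facts by auto
lemma HComp_in[simp]: "\<lbrakk>f \<in> Cell A; g \<in> Cell A; Tgt A (Dm A f) = Src A (Dm A g)\<rbrakk> \<Longrightarrow> g \<star> f \<in> Cell A"
  using horiz_facts by auto
lemma HComp_unit[simp]: "f \<in> Cell A \<Longrightarrow> Tgt A (Dm A f) = x \<Longrightarrow> Idc A (Idm A x) \<star> f = f" "f \<in> Cell A \<Longrightarrow> Src A (Dm A f) = x \<Longrightarrow> f \<star> Idc A (Idm A x) = f"
  using horiz_facts by auto
lemma HComp_assoc: "\<lbrakk>f \<in> Cell A; g \<in> Cell A; k \<in> Cell A; Tgt A (Dm A f) = Src A (Dm A g); Tgt A (Dm A g) = Src A (Dm A k)\<rbrakk> \<Longrightarrow> (k \<star> g) \<star> f = k \<star> (g \<star> f)"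
  using horiz_facts by auto
lemmas [simp] = Dm_HComp Cd_HComp globular_src globular_tgt HComp_Idc
end

lemma shape_simps[simp]: "Obj pullback_shape = UNIV" "Mor pullback_shape = UNIV" "Cell pullback_shape = UNIV"
  "Dm pullback_shape u = u" "Cd pullback_shape u = u" "Idc pullback_shape u = u" "VComp pullback_shape v u = u"
  "HComp pullback_shape v u = cospan_cmp v u" "Comp pullback_shape v u = cospan_cmp v u" "Idm pullback_shape x = CId x"
  "Src pullback_shape (CId x) = x" "Tgt pullback_shape (CId x) = x"
  "Src pullback_shape LftArr = Lft" "Tgt pullback_shape LftArr = Apex"
  "Src pullback_shape RgtArr = Rgt" "Tgt pullback_shape RgtArr = Apex"
  by (auto simp: pullback_shape_def locally_discrete_def cospan_cat_def)

interpretation ex:  two_category ex_cat by (rule ex_two_category)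

lemma ex_Obj[simp]: "Obj ex_cat = UNIV" by (simp add: ex_cat_def presented_2cat_def)
lemma ex_gen_simps[simp]: "ex_gen m \<in> Mor ex_cat" "Src ex_cat (ex_gen m) = ex_src m" "Tgt ex_cat (ex_gen m) = ex_tgt m"
  unfolding ex_cat_def ex_gen_def using p_src[OF ex_valid, of "Gen1 m"] p_tgt[OF ex_valid, of "Gen1 m"]
  by (auto intro!: p_morI[OF ex_valid]) (auto simp: ex_pres_def)

lemma ex_rels: "ex_gen mc \<cdot>\<^bsub>ex_cat\<^esub> ex_gen mlam1 = ex_gen mb \<cdot>\<^bsub>ex_cat\<^esub> ex_gen mlam0"
   "ex_gen mc \<cdot>\<^bsub>ex_cat\<^esub> ex_gen malpha1 = ex_gen mb \<cdot>\<^bsub>ex_cat\<^esub> ex_gen malpha0"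
proof -
  have *: "ex_gen m \<cdot>\<^bsub>ex_cat\<^esub> ex_gen n = cls1 ex_pres (Comp1 (Gen1 m) (Gen1 n))" if "ex_src m = ex_tgt n" for m n
    unfolding ex_cat_def ex_gen_def by (rule p_comp[OF ex_valid]) (use that in \<open>auto simp: ex_pres_def\<close>)
  show "ex_gen mc \<cdot>\<^bsub>ex_cat\<^esub> ex_gen mlam1 = ex_gen mb \<cdot>\<^bsub>ex_cat\<^esub> ex_gen mlam0" by (simp add: *) (rule cls1_eq[symmetric], rule eq1_rel, simp add: ex_pres_def)
  show "ex_gen mc \<cdot>\<^bsub>ex_cat\<^esub> ex_gen malpha1 = ex_gen mb \<cdot>\<^bsub>ex_cat\<^esub> ex_gen malpha0" by (simp add: *) (rule cls1_eq[symmetric], rule eq1_rel, simp add: ex_pres_def)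
qed

lemma ex_F_ar_simps[simp]: "ex_F_ar u \<in> Mor ex_cat" "Src ex_cat (ex_F_ar u) = ex_F_ob (Src pullback_shape u)" 
   "Tgt ex_cat (ex_F_ar u) = ex_F_ob (Tgt pullback_shape u)"
  by (cases u; simp)+

lemma ex_F_ar_cmp: "Tgt pullback_shape u = Src pullback_shape w \<Longrightarrow> ex_F_ar (cospan_cmp w u) = ex_F_ar w \<cdot>\<^bsub>ex_cat\<^esub> ex_F_ar u"
  by (cases u; cases w) auto

lemma ex_F_two_functor: "two_functor pullback_shape ex_cat ex_F"
  unfolding two_functor_def ex_F_def by (auto simp: ex_F_ar_cmp PiE_UNIV_domain)

definition ex_cone where "ex_cone a b = (fob (diag pullback_shape ex_cat) (Src ex_cat a), ex_F, 
   case_cospan_ob a (ex_gen mb \<cdot>\<^bsub>ex_cat\<^esub> a) b)"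

lemma const_two_functor: assumes "two_category I" "two_category A" "X \<in> Obj A" shows "two_functor I A (const_functor I A X)"
proof -
  interpret I: two_category I by fact
  interpret A: two_category A by fact
  show ?thesis unfolding two_functor_def const_functor_def using assms(3) by auto
qed

lemma ex_cone_is_2cone: assumes "a \<in> Mor ex_cat" "b \<in> Mor ex_cat" "Src ex_cat a = X" "Src ex_cat b = X" "Tgt ex_cat a = oB" "Tgt ex_cat b = oC"
   "ex_gen mc \<cdot>\<^bsub>ex_cat\<^esub> b = ex_gen mb \<cdot>\<^bsub>ex_cat\<^esub> a"
  shows "is_2cone pullback_shape ex_cat ex_F X (ex_cone a b)"
proof -
  have 1: "two_natural pullback_shape ex_cat (const_functor pullback_shape ex_cat X) ex_F (case_cospan_ob a (ex_gen mb \<cdot>\<^bsub>ex_cat\<^esub> a) b)"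
    unfolding two_natural_def
    apply (intro conjI ballI)
    subgoal using assms by (auto split: cospan_ob.splits)
    subgoal for i using assms by (cases i) (auto simp: const_functor_def ex_F_def)
    subgoal for i using assms by (cases i) (auto simp: const_functor_def ex_F_def)
    subgoal for u using assms by (cases u) (auto simp: const_functor_def ex_F_def split: cospan_ob.splits)
    subgoal for u using assms by (cases u) (auto simp: const_functor_def ex_F_def split: cospan_ob.splits)
    done
  show ?thesis unfolding is_2cone_def ex_cone_def
    using 1 assms ex_F_two_functor const_two_functor[OF shape_two_category ex_two_category, of X] by (auto simp: functor_2cat_def diag_def)
qed

lemma ex_lam_is_2cone: "is_2cone pullback_shape ex_cat ex_F oL ex_lam"
proof -
  have "ex_lam_comp = case_cospan_ob (ex_gen mlam0) (ex_gen mb \<cdot>\<^bsub>ex_cat\<^esub> ex_gen mlam0) (ex_gen mlam1)"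
    by (rule ext, case_tac x) auto
  then have "ex_lam = ex_cone (ex_gen mlam0) (ex_gen mlam1)" unfolding ex_lam_def ex_cone_def by simp
  then show ?thesis using ex_cone_is_2cone[of "ex_gen mlam0" "ex_gen mlam1" oL] ex_rels by simp
qed

end

theory Submission
  imports Defs
begin

text \<open>The 2-category \<open>A\<close> has 17 morphisms and only three 2-morphisms that are not identities,
  \<open>\<gamma>\<^sub>0\<close>, \<open>\<gamma>\<^sub>1\<close> and \<open>b * \<gamma>\<^sub>0 = c * \<gamma>\<^sub>1\<close>.  The number of occurrences of \<open>f\<close> in a word is invariant
  under the relations and drops from 1 to 0 along each of the three; hence they are not
  endomorphisms and \<open>A\<close> is locally thin.  So for 2-terminality it is enough that every 2-cone
  \<open>\<mu>\<close> admits exactly one \<open>g\<close> for which a modification \<open>\<lambda> \<Delta>g \<rightarrow> \<mu>\<close> exists.  The only 2-cones are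
  \<open>\<lambda>\<close>, \<open>\<lambda> \<Delta>f\<close> and \<open>\<alpha>\<close>, served by the identity, by \<open>f\<close>, and by \<open>f\<close> with \<open>(\<gamma>\<^sub>0, \<gamma>\<^sub>1)\<close>.
  As \<open>f\<close> is the only morphism \<open>X \<rightarrow> L\<close> and \<open>\<lambda>\<^sub>0 f \<noteq> \<alpha>\<^sub>0\<close>, the 2-cone \<open>\<alpha>\<close> is not of the form
  \<open>\<lambda> \<Delta>g\<close>.\<close>

section \<open>2-terminal objects of lax slices over locally thin 2-categories\<close>

definition locally_thin :: "('o, 'm, 'c) two_cat \<Rightarrow> bool" where
  "locally_thin A \<longleftrightarrow>
     (\<forall>a\<in>Cell A. \<forall>b\<in>Cell A. Dm A a = Dm A b \<longrightarrow> Cd A a = Cd A b \<longrightarrow> a = b)"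

text \<open>Thinness is inherited componentwise: each component of a modification has its domain and
  codomain prescribed. Extensionality covers the values outside \<open>Obj I\<close>.\<close>

lemma functor_2cat_locally_thin:
  assumes "locally_thin A"
  shows "locally_thin (functor_2cat I A)"
proof -
  have "\<phi> = \<psi>" if "modification I A F G \<mu> \<nu> \<phi>" "modification I A F G \<mu> \<nu> \<psi>" for F G \<mu> \<nu> \<phi> \<psi>
  proof (rule PiE_ext)
    show "\<phi> \<in> Obj I \<rightarrow>\<^sub>E Cell A" "\<psi> \<in> Obj I \<rightarrow>\<^sub>E Cell A"
      using that by (simp_all add: modification_def)
    show "\<phi> i = \<psi> i" if "i \<in> Obj I" for i
      using that \<open>modification I A F G \<mu> \<nu> \<phi>\<close> \<open>modification I A F G \<mu> \<nu> \<psi>\<close> assms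
      unfolding modification_def locally_thin_def by (metis PiE_mem)
  qed
  then show ?thesis
    unfolding locally_thin_def functor_2cat_def by fastforce
qed

lemma isomorphic_terminal_catI:
  assumes "Ob C = {x}" "Ar C = {u}" "dom C u = x" "cod C u = x" "ide C x = u" "cmp C u u = u"
  shows "isomorphic_cats C terminal_cat"
proof -
  have "is_iso_functor C terminal_cat \<lparr>on_ob = \<lambda>_. (), on_ar = \<lambda>_. ()\<rparr>"
    unfolding is_iso_functor_def
    by (rule conjI, use assms in \<open>simp add: is_functor_def terminal_cat_def\<close>,
        rule exI[of _ "\<lparr>on_ob = \<lambda>_. x, on_ar = \<lambda>_. u\<rparr>"])
      (use assms in \<open>auto simp: is_functor_def terminal_cat_def\<close>)
  then show ?thesis unfolding isomorphic_cats_def by blast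
qed

text \<open>Makes \<open>Idc A f\<close> a 2-morphism of the lax slice from
  \<open>(f, \<phi>)\<close> to itself: whiskering \<open>\<nu>\<close> with an identity gives
  identity components, and the unit law of \<open>A\<close> removes them.\<close>

lemma slice_Idc_condition:
  assumes "two_category A" "is_2cone I A F L \<nu>" "f \<in> Mor A" "Tgt A f = L"
    and "\<phi> \<in> Cell (functor_2cat I A)"
    and "Dm (functor_2cat I A) \<phi> = \<nu> \<cdot>\<^bsub>functor_2cat I A\<^esub> fmor (diag I A) f"
  shows "\<phi> \<bullet>\<^bsub>functor_2cat I A\<^esub>
    (Idc (functor_2cat I A) \<nu> \<star>\<^bsub>functor_2cat I A\<^esub> fcell (diag I A) (Idc A f)) = \<phi>"
proof -
  interpret A: two_category A by (rule assms(1))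
  obtain \<nu>' where \<nu>: "\<nu> = (const_functor I A L, F, \<nu>')" "L \<in> Obj A"
    and \<nu>': "two_natural I A (const_functor I A L) F \<nu>'"
    using assms(2) by (auto simp: is_2cone_def functor_2cat_def diag_def)
  have \<nu>'_in: "\<nu>' i \<in> Mor A" "Src A (\<nu>' i) = L" if "i \<in> Obj I" for i
    using \<nu>' that by (auto simp: two_natural_def const_functor_def)
  obtain m n c where \<phi>: "\<phi> = (m, n, c)" by (cases \<phi>)
  have m: "m = (const_functor I A (Src A f), F, \<lambda>i\<in>Obj I. \<nu>' i \<cdot>\<^bsub>A\<^esub> f)"
    using assms(3,4,6)
    by (simp add: \<phi> \<nu> functor_2cat_def diag_def const_nat_def nt_comp_def cong: restrict_cong)
  have c: "c \<in> Obj I \<rightarrow>\<^sub>E Cell A" "\<And>i. i \<in> Obj I \<Longrightarrow> Dm A (c i) = \<nu>' i \<cdot>\<^bsub>A\<^esub> f"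
    using assms(5) by (auto simp: \<phi> m functor_2cat_def modification_def)
  \<comment> \<open>Outside \<open>Obj I\<close> both families are \<open>undefined\<close>, since
    \<open>c\<close> is extensional.\<close>
  have "(\<lambda>i\<in>Obj I. c i \<bullet>\<^bsub>A\<^esub> (Idc A (\<nu>' i) \<star>\<^bsub>A\<^esub> Idc A f)) = c"
    using c(2) PiE_mem[OF c(1)] assms(3,4) by (intro ext) (auto simp: \<nu>'_in PiE_arb[OF c(1)])
  then show ?thesis
    using assms(3,4)
    by (simp add: \<phi> m \<nu> functor_2cat_def diag_def const_nat_def const_modif_def nt_comp_def
        cong: restrict_cong)
qed

text \<open>Unique existence of \<open>f\<close> is enough: thinness of \<open>[I, A]\<close> then
  determines the modification, and thinness of \<open>A\<close> leaves only the identity as an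
  endomorphism of \<open>f\<close>. Each hom-category into \<open>(L, \<nu>)\<close> thus has one
  object and one arrow.\<close>

lemma lax_slice_two_terminalI:
  assumes A: "two_category A" and thin: "locally_thin A" and cone: "is_2cone I A F L \<nu>"
    and ex1: "\<And>X \<mu>. is_2cone I A F X \<mu> \<Longrightarrow>
      \<exists>!f. f \<in> Mor A \<and> Src A f = X \<and> Tgt A f = L \<and>
        (\<exists>\<phi>\<in>Cell (functor_2cat I A).
           Dm (functor_2cat I A) \<phi> = \<nu> \<cdot>\<^bsub>functor_2cat I A\<^esub> fmor (diag I A) f \<and>
           Cd (functor_2cat I A) \<phi> = \<mu>)"
  shows "two_terminal (lax_slice I A F) (L, \<nu>)"
proof -
  interpret A: two_category A by (rule A)
  have "isomorphic_cats (hom_cat (lax_slice I A F) (X, \<mu>) (L, \<nu>)) terminal_cat"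
    if \<mu>: "is_2cone I A F X \<mu>" for X \<mu>
  proof -
    obtain f \<phi> where f: "f \<in> Mor A" "Src A f = X" "Tgt A f = L"
      and \<phi>: "\<phi> \<in> Cell (functor_2cat I A)"
        "Dm (functor_2cat I A) \<phi> = \<nu> \<cdot>\<^bsub>functor_2cat I A\<^esub> fmor (diag I A) f"
        "Cd (functor_2cat I A) \<phi> = \<mu>"
      using ex1[OF \<mu>] by blast
    define p where "p = ((X, \<mu>), (L, \<nu>), f, \<phi>)"
    have p: "p \<in> slice_mors I A F"
      using \<mu> cone f \<phi> by (simp add: p_def slice_mors_def slice_obs_def)
    have p_unique: "q = p"
      if q_in: "q \<in> slice_mors I A F" and q_ends: "fst q = (X, \<mu>)" "fst (snd q) = (L, \<nu>)" for q
    proof -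
      obtain g \<psi> where q: "q = ((X, \<mu>), (L, \<nu>), g, \<psi>)"
        using q_ends by (metis prod.collapse)
      have g: "g \<in> Mor A" "Src A g = X" "Tgt A g = L"
        and \<psi>: "\<psi> \<in> Cell (functor_2cat I A)"
          "Dm (functor_2cat I A) \<psi> = \<nu> \<cdot>\<^bsub>functor_2cat I A\<^esub> fmor (diag I A) g"
          "Cd (functor_2cat I A) \<psi> = \<mu>"
        using q_in by (simp_all add: q slice_mors_def)
      have "g = f"
        using ex1[OF \<mu>] f \<phi> g \<psi> by blast
      moreover from this have "\<psi> = \<phi>"
        using functor_2cat_locally_thin[OF thin, of I] \<phi> \<psi> unfolding locally_thin_def by metis
      ultimately show ?thesis
        by (simp add: p_def q)
    qed
    have cells: "\<alpha> = Idc A f" if "\<alpha> \<in> Cell A" "Dm A \<alpha> = f" "Cd A \<alpha> = f" for \<alpha>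
      using that thin f A.Cell_in(3-5)[of f] unfolding locally_thin_def by metis
    let ?H = "hom_cat (lax_slice I A F) (X, \<mu>) (L, \<nu>)"
    have "Ob ?H = {p}"
      using p by (auto simp: hom_cat_def lax_slice_def intro!: p_unique) (auto simp: p_def)
    moreover have "Ar ?H = {(p, p, Idc A f)}"
    proof (intro subset_antisym subsetI)
      fix a assume "a \<in> Ar ?H"
      then obtain q r \<alpha> where a: "a = (q, r, \<alpha>)" "q \<in> slice_mors I A F" "r \<in> slice_mors I A F"
        "fst q = (X, \<mu>)" "fst (snd q) = (L, \<nu>)" "fst r = fst q" "fst (snd r) = fst (snd q)"
        "\<alpha> \<in> Cell A" "Dm A \<alpha> = fst (snd (snd q))" "Cd A \<alpha> = fst (snd (snd r))"
        by (auto simp: hom_cat_def lax_slice_def)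
      then have "q = p" "r = p"
        by (auto intro: p_unique)
      with a show "a \<in> {(p, p, Idc A f)}"
        by (simp add: cells p_def)
    next
      fix a assume "a \<in> {(p, p, Idc A f)}"
      with p f slice_Idc_condition[OF A cone f(1,3) \<phi>(1,2)] show "a \<in> Ar ?H"
        by (simp add: hom_cat_def lax_slice_def p_def)
    qed
    ultimately show ?thesis
      using f by (intro isomorphic_terminal_catI)
        (auto simp: hom_cat_def lax_slice_def p_def)
  qed
  then show ?thesis
    using cone by (auto simp: two_terminal_def lax_slice_def slice_obs_def)
qed

section \<open>Morphisms of the example\<close>

primrec gen_count :: "'m \<Rightarrow> ('o, 'm) term1 \<Rightarrow> nat" where
  "gen_count g (Id1 x) = 0"
| "gen_count g (Gen1 m) = (if m = g then 1 else 0)"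
| "gen_count g (Comp1 q p) = gen_count g q + gen_count g p"

text \<open>Unit and associativity laws only drop identities or move brackets, so only the
  generating relations can change the count.\<close>

lemma eq1_gen_count:
  assumes "eq1 P p q"
    and "\<And>p q. (p, q) \<in> rel1 P \<Longrightarrow> gen_count g p = gen_count g q"
  shows "gen_count g p = gen_count g q"
  using assms(1) by induction (auto simp: assms(2))

definition f_count :: "ex_1cell \<Rightarrow> nat" where
  "f_count m = gen_count mf (rep m)"

text \<open>Neither relation of \<open>ex_pres\<close> mentions \<open>mf\<close>, so the count does
  not depend on the representative chosen by \<open>rep\<close>.\<close>

lemma f_count_cls1:
  assumes "wf1 ex_pres p" shows "f_count (cls1 ex_pres p) = gen_count mf p"
  unfolding f_count_def
  by (rule eq1_gen_count[OF rep1[OF assms], symmetric]) (auto simp: ex_pres_def)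

lemma ex_Mor_cls1:
  assumes "m \<in> Mor ex_cat"
  obtains p where "wf1 ex_pres p" "m = cls1 ex_pres p"
  using assms p_mor[OF ex_valid] unfolding ex_cat_def by blast

lemma f_count_Comp:
  assumes "m \<in> Mor ex_cat" "n \<in> Mor ex_cat" "Tgt ex_cat m = Src ex_cat n"
  shows "f_count (n \<cdot>\<^bsub>ex_cat\<^esub> m) = f_count n + f_count m"
proof -
  obtain p q where "wf1 ex_pres p" "m = cls1 ex_pres p" "wf1 ex_pres q" "n = cls1 ex_pres q"
    using assms ex_Mor_cls1 by metis
  with assms(3) show ?thesis
    by (simp add: ex_cat_def p_comp[OF ex_valid] p_src[OF ex_valid] p_tgt[OF ex_valid] f_count_cls1)
qed

lemma f_count_simps [simp]:
  "f_count (Idm ex_cat x) = 0"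
  "f_count (ex_gen m) = (if m = mf then 1 else 0)"
  by (simp_all add: ex_cat_def p_idm[OF ex_valid] ex_gen_def f_count_cls1)

text \<open>The relation \<open>ex_rels(1)\<close> precomposed with \<open>ex_gen mf\<close>,
  bracketed as in the normal forms below.\<close>

lemma ex_rels_f:
  "ex_gen mc \<cdot>\<^bsub>ex_cat\<^esub> (ex_gen mlam1 \<cdot>\<^bsub>ex_cat\<^esub> ex_gen mf)
    = ex_gen mb \<cdot>\<^bsub>ex_cat\<^esub> (ex_gen mlam0 \<cdot>\<^bsub>ex_cat\<^esub> ex_gen mf)"
  using ex.Comp_assoc[of "ex_gen mf" "ex_gen mlam1" "ex_gen mc"]
    ex.Comp_assoc[of "ex_gen mf" "ex_gen mlam0" "ex_gen mb"]
  by (simp add: ex_rels)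

text \<open>Normal forms: five identities, seven generators and five composites. Composites ending
  with \<open>mc\<close> are rewritten to end with \<open>mb\<close>.\<close>

definition ex_arrows :: "ex_1cell set" where
  "ex_arrows = range (Idm ex_cat) \<union> range ex_gen \<union>
     {ex_gen mlam0 \<cdot>\<^bsub>ex_cat\<^esub> ex_gen mf, ex_gen mlam1 \<cdot>\<^bsub>ex_cat\<^esub> ex_gen mf,
      ex_gen mb \<cdot>\<^bsub>ex_cat\<^esub> ex_gen mlam0, ex_gen mb \<cdot>\<^bsub>ex_cat\<^esub> ex_gen malpha0,
      ex_gen mb \<cdot>\<^bsub>ex_cat\<^esub> (ex_gen mlam0 \<cdot>\<^bsub>ex_cat\<^esub> ex_gen mf)}"

lemma ex_arrows_subset: "ex_arrows \<subseteq> Mor ex_cat"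
  by (auto simp: ex_arrows_def)

text \<open>Every normal form other than an identity is a product of generators, so by associativity
  it suffices to compose on the left with one generator at a time.\<close>

lemma ex_arrows_Comp:
  assumes "m \<in> ex_arrows" "n \<in> ex_arrows" "Tgt ex_cat m = Src ex_cat n"
  shows "n \<cdot>\<^bsub>ex_cat\<^esub> m \<in> ex_arrows"
proof -
  have gens: "ex_gen b \<cdot>\<^bsub>ex_cat\<^esub> ex_gen a \<in> ex_arrows" if "ex_tgt a = ex_src b" for a b
    using that by (cases a; cases b) (auto simp: ex_arrows_def ex_rels)
  have gen_left: "ex_gen b \<cdot>\<^bsub>ex_cat\<^esub> m \<in> ex_arrows"
    if "m \<in> ex_arrows" "Tgt ex_cat m = ex_src b" for b m
    using that(1)[unfolded ex_arrows_def] that(2)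
    by (cases b) (auto simp: gens ex_rels_f, auto simp: ex_arrows_def)
  show ?thesis
    using assms(2)[unfolded ex_arrows_def] assms(1,3) ex_arrows_subset
    by (auto simp: ex.Comp_assoc gen_left subset_iff)
qed

lemma ex_Mor_arrows: "Mor ex_cat = ex_arrows"
proof -
  have "wf1 ex_pres p \<Longrightarrow> cls1 ex_pres p \<in> ex_arrows" for p
  proof (induction p)
    case (Id1 x)
    show ?case by (simp add: ex_arrows_def ex_cat_def p_idm[OF ex_valid])
  next
    case (Gen1 m)
    show ?case by (simp add: ex_arrows_def flip: ex_gen_def)
  next
    case (Comp1 q p)
    then show ?case
      using ex_arrows_Comp[of "cls1 ex_pres p" "cls1 ex_pres q"]
      by (simp add: ex_cat_def p_comp[OF ex_valid] p_src[OF ex_valid] p_tgt[OF ex_valid])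
  qed
  with ex_arrows_subset show ?thesis
    by (auto elim: ex_Mor_cls1)
qed

lemma ex_Mor_cases:
  assumes "m \<in> Mor ex_cat"
  shows "m \<in> {ex_gen mlam0 \<cdot>\<^bsub>ex_cat\<^esub> ex_gen mf, ex_gen mlam1 \<cdot>\<^bsub>ex_cat\<^esub> ex_gen mf,
     ex_gen mb \<cdot>\<^bsub>ex_cat\<^esub> ex_gen mlam0, ex_gen mb \<cdot>\<^bsub>ex_cat\<^esub> ex_gen malpha0,
     ex_gen mb \<cdot>\<^bsub>ex_cat\<^esub> (ex_gen mlam0 \<cdot>\<^bsub>ex_cat\<^esub> ex_gen mf),
     ex_gen mf, ex_gen mlam0, ex_gen mlam1, ex_gen malpha0, ex_gen malpha1, ex_gen mb, ex_gen mc,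
     Idm ex_cat oX, Idm ex_cat oL, Idm ex_cat oA, Idm ex_cat oB, Idm ex_cat oC}"
proof -
  have "UNIV = {oX, oL, oA, oB, oC}"
    by (auto intro: ex_ob.exhaust)
  then have ids: "range (Idm ex_cat) = Idm ex_cat ` {oX, oL, oA, oB, oC}"
    by simp
  have "UNIV = {mf, mlam0, mlam1, malpha0, malpha1, mb, mc}"
    by (auto intro: ex_mor.exhaust)
  then have gens: "range ex_gen = ex_gen ` {mf, mlam0, mlam1, malpha0, malpha1, mb, mc}"
    by simp
  show ?thesis
    using assms unfolding ex_Mor_arrows ex_arrows_def ids gens by simp
qed

text \<open>The arrows into L, B and C govern 2-cones and their factorisations; those into X and out
  of A, B and C govern whiskering of the generating 2-morphisms.\<close>

lemma ex_hom:
  assumes "m \<in> Mor ex_cat"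
  shows ex_to_oX: "Tgt ex_cat m = oX \<Longrightarrow> m = Idm ex_cat oX"
    and ex_to_oL: "Tgt ex_cat m = oL \<Longrightarrow> m = Idm ex_cat oL \<or> m = ex_gen mf"
    and ex_to_oB: "Tgt ex_cat m = oB \<Longrightarrow> m \<in> {Idm ex_cat oB, ex_gen mlam0, ex_gen malpha0,
      ex_gen mlam0 \<cdot>\<^bsub>ex_cat\<^esub> ex_gen mf}"
    and ex_to_oC: "Tgt ex_cat m = oC \<Longrightarrow> m \<in> {Idm ex_cat oC, ex_gen mlam1, ex_gen malpha1,
      ex_gen mlam1 \<cdot>\<^bsub>ex_cat\<^esub> ex_gen mf}"
    and ex_from_oB: "Src ex_cat m = oB \<Longrightarrow> m = Idm ex_cat oB \<or> m = ex_gen mb"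
    and ex_from_oC: "Src ex_cat m = oC \<Longrightarrow> m = Idm ex_cat oC \<or> m = ex_gen mc"
    and ex_from_oA: "Src ex_cat m = oA \<Longrightarrow> m = Idm ex_cat oA"
  using ex_Mor_cases[OF assms] by (elim insertE emptyE; simp)+

section \<open>2-morphisms of the example\<close>

definition ex_gen2 :: "ex_cell \<Rightarrow> ex_2cell" where
  "ex_gen2 c = cls2 ex_pres (Gen2 c)"

lemma ex_gen2_simps [simp]:
  "ex_gen2 c \<in> Cell ex_cat"
  "Dm ex_cat (ex_gen2 gamma0) = ex_gen mlam0 \<cdot>\<^bsub>ex_cat\<^esub> ex_gen mf"
  "Dm ex_cat (ex_gen2 gamma1) = ex_gen mlam1 \<cdot>\<^bsub>ex_cat\<^esub> ex_gen mf"
  "Cd ex_cat (ex_gen2 gamma0) = ex_gen malpha0"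
  "Cd ex_cat (ex_gen2 gamma1) = ex_gen malpha1"
proof -
  have "ex_gen m \<cdot>\<^bsub>ex_cat\<^esub> ex_gen n = cls1 ex_pres (Comp1 (Gen1 m) (Gen1 n))"
    if "ex_src m = ex_tgt n" for m n
    unfolding ex_cat_def ex_gen_def
    by (rule p_comp[OF ex_valid]) (use that in \<open>auto simp: ex_pres_def\<close>)
  then show
    "Dm ex_cat (ex_gen2 gamma0) = ex_gen mlam0 \<cdot>\<^bsub>ex_cat\<^esub> ex_gen mf"
    "Dm ex_cat (ex_gen2 gamma1) = ex_gen mlam1 \<cdot>\<^bsub>ex_cat\<^esub> ex_gen mf"
    by (simp_all add: ex_gen2_def ex_cat_def p_dm[OF ex_valid]) (simp_all add: ex_pres_def)
  show "ex_gen2 c \<in> Cell ex_cat"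
    "Cd ex_cat (ex_gen2 gamma0) = ex_gen malpha0"
    "Cd ex_cat (ex_gen2 gamma1) = ex_gen malpha1"
    by (simp_all add: ex_gen2_def ex_gen_def ex_cat_def p_cd[OF ex_valid] p_cellI[OF ex_valid])
      (simp_all add: ex_pres_def)
qed

lemma ex_rel2:
  "Idc ex_cat (ex_gen mc) \<star>\<^bsub>ex_cat\<^esub> ex_gen2 gamma1 = Idc ex_cat (ex_gen mb) \<star>\<^bsub>ex_cat\<^esub> ex_gen2 gamma0"
proof -
  have "Idc ex_cat (ex_gen m) \<star>\<^bsub>ex_cat\<^esub> ex_gen2 c = cls2 ex_pres (HComp2 (Id2 (Gen1 m)) (Gen2 c))"
    if "wf2 ex_pres (HComp2 (Id2 (Gen1 m)) (Gen2 c))" for m c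
    using p_hcomp[OF ex_valid that] that
    by (simp add: ex_cat_def ex_gen2_def ex_gen_def p_idc[OF ex_valid])
  moreover have "cls2 ex_pres (HComp2 (Id2 (Gen1 mb)) (Gen2 gamma0))
      = cls2 ex_pres (HComp2 (Id2 (Gen1 mc)) (Gen2 gamma1))"
    by (rule cls2_eq, rule eq2_rel) (simp add: ex_pres_def)
  ultimately show ?thesis by (simp add: ex_pres_def)
qed

text \<open>By \<open>ex_rel2\<close> the third element is also the whiskering of
  \<open>gamma1\<close> with \<open>mc\<close>.\<close>

definition ex_proper_cells :: "ex_2cell set" where
  "ex_proper_cells = {ex_gen2 gamma0, ex_gen2 gamma1, Idc ex_cat (ex_gen mb) \<star>\<^bsub>ex_cat\<^esub> ex_gen2 gamma0}"

definition ex_cells :: "ex_2cell set" where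
  "ex_cells = Idc ex_cat ` Mor ex_cat \<union> ex_proper_cells"

text \<open>The endpoints prevent two proper cells from composing horizontally, and the drop of
  \<open>f_count\<close> prevents them from composing vertically.\<close>

lemma ex_proper_cell:
  assumes "s \<in> ex_proper_cells"
  shows "s \<in> Cell ex_cat" "Src ex_cat (Dm ex_cat s) = oX" "Tgt ex_cat (Dm ex_cat s) \<noteq> oX"
    and "f_count (Dm ex_cat s) = 1" "f_count (Cd ex_cat s) = 0"
  using assms by (auto simp: ex_proper_cells_def f_count_Comp)

lemma ex_cellsE:
  assumes "s \<in> ex_cells"
  obtains (ide) m where "m \<in> Mor ex_cat" "s = Idc ex_cat m" | (proper) "s \<in> ex_proper_cells"
  using assms by (auto simp: ex_cells_def)

lemma ex_cells_subset: "ex_cells \<subseteq> Cell ex_cat"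
  by (auto simp: ex_cells_def ex_proper_cell)

lemma ex_cells_VComp:
  assumes "s \<in> ex_cells" "t \<in> ex_cells" "Cd ex_cat s = Dm ex_cat t"
  shows "t \<bullet>\<^bsub>ex_cat\<^esub> s \<in> ex_cells"
  using assms(1)
proof (cases rule: ex_cellsE)
  case (ide m)
  with assms ex_cells_subset show ?thesis by auto
next
  case s: proper
  from assms(2) show ?thesis
  proof (cases rule: ex_cellsE)
    case (ide m)
    with assms s show ?thesis by (simp add: ex_proper_cell)
  next
    case proper
    \<comment> \<open>Impossible case: the middle morphism would have \<open>f_count\<close> both 0
      and 1.\<close>
    with s assms(3) ex_proper_cell(4)[OF proper] ex_proper_cell(5)[OF s] show ?thesis by simp
  qed
qed

lemma ex_cells_HComp:
  assumes "s \<in> ex_cells" "t \<in> ex_cells" "Tgt ex_cat (Dm ex_cat s) = Src ex_cat (Dm ex_cat t)"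
  shows "t \<star>\<^bsub>ex_cat\<^esub> s \<in> ex_cells"
  using assms(1)
proof (cases rule: ex_cellsE)
  case s: (ide m)
  from assms(2) show ?thesis
  proof (cases rule: ex_cellsE)
    case (ide n)
    with s assms(3) show ?thesis by (simp add: ex_cells_def)
  next
    case proper
    \<comment> \<open>A proper cell starts at X, and only the identity arrives there, so whiskering
      on the right changes nothing.\<close>
    with s assms(3) have "m = Idm ex_cat oX"
      by (simp add: ex_proper_cell ex_to_oX)
    with s assms(2) proper show ?thesis by (simp add: ex_proper_cell)
  qed
next
  case s: proper
  from assms(2) show ?thesis
  proof (cases rule: ex_cellsE)
    case (ide n)
    \<comment> \<open>The target of \<open>s\<close> is A, B or C, where only identities,
      \<open>mb\<close> and \<open>mc\<close> start; \<open>ex_rel2\<close> merges the two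
      nontrivial whiskerings.\<close>
    have "t \<star>\<^bsub>ex_cat\<^esub> s = s \<or> t \<star>\<^bsub>ex_cat\<^esub> s = Idc ex_cat (ex_gen mb) \<star>\<^bsub>ex_cat\<^esub> ex_gen2 gamma0"
      using s ide assms(3) ex_from_oA[of n] ex_from_oB[of n] ex_from_oC[of n]
      by (auto simp: ex_proper_cells_def ex_rel2)
    with s show ?thesis by (auto simp: ex_cells_def ex_proper_cells_def)
  next
    case proper
    with s assms(3) show ?thesis by (simp add: ex_proper_cell)
  qed
qed

lemma ex_Cell_cells: "Cell ex_cat = ex_cells"
proof -
  have "wf2 ex_pres p \<Longrightarrow> cls2 ex_pres p \<in> ex_cells" for p
  proof (induction p)
    case (Id2 p)
    then show ?case
      by (auto simp: ex_cells_def ex_cat_def p_idc[OF ex_valid, symmetric] p_morI[OF ex_valid])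
  next
    case (Gen2 m)
    show ?case by (cases m) (simp_all add: ex_cells_def ex_proper_cells_def flip: ex_gen2_def)
  next
    case (VComp2 q p)
    then show ?case
      using ex_cells_VComp[of "cls2 ex_pres p" "cls2 ex_pres q"]
      \<comment> \<open>Well-formedness gives composability only modulo \<open>eq1\<close>;
        \<open>cls1_eq\<close> turns this into equality of the middle morphisms.\<close>
      by (simp add: cls1_eq ex_cat_def p_vcomp[OF ex_valid] p_dm[OF ex_valid] p_cd[OF ex_valid])
  next
    case (HComp2 q p)
    then show ?case
      using ex_cells_HComp[of "cls2 ex_pres p" "cls2 ex_pres q"]
      by (simp add: ex_cat_def p_hcomp[OF ex_valid] p_dm[OF ex_valid] wf2_bds[OF ex_valid]
          p_src[OF ex_valid] p_tgt[OF ex_valid])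
  qed
  with ex_cells_subset show ?thesis
    by (auto simp: ex_cat_def elim: p_cellE[OF ex_valid])
qed

text \<open>The targets B, C and A tell the three proper cells apart. A proper cell is never
  parallel to an identity, because its domain and codomain differ in \<open>f_count\<close>.\<close>

lemma ex_locally_thin: "locally_thin ex_cat"
proof -
  have proper: "s = t" if "s \<in> ex_proper_cells" "t \<in> ex_proper_cells" "Dm ex_cat s = Dm ex_cat t" for s t
    using that(1,2) arg_cong[OF that(3), of "Tgt ex_cat"] by (auto simp: ex_proper_cells_def)
  show ?thesis
    unfolding locally_thin_def ex_Cell_cells
  proof (intro ballI impI)
    fix s t
    assume st: "s \<in> ex_cells" "t \<in> ex_cells" "Dm ex_cat s = Dm ex_cat t" "Cd ex_cat s = Cd ex_cat t"
    show "s = t"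
      using st(1)
    proof (cases rule: ex_cellsE)
      case (ide m)
      from st(2) show ?thesis
      proof (cases rule: ex_cellsE)
        case proper
        with ide st(3,4) show ?thesis using ex_proper_cell(4,5)[of t] by simp
      qed (use ide st(3) in simp)
    next
      case s: proper
      from st(2) show ?thesis
      proof (cases rule: ex_cellsE)
        case (ide m)
        with s st(3,4) show ?thesis using ex_proper_cell(4,5)[of s] by simp
      qed (use s st(3) proper in blast)
    qed
  qed
qed

section \<open>2-cones of the example\<close>

text \<open>Naturality at \<open>LftArr\<close> and \<open>RgtArr\<close> expresses the component at
  \<open>Apex\<close> through either leg, so the two legs determine the cone.\<close>

lemma ex_2cone_cases:
  assumes "is_2cone pullback_shape ex_cat ex_F X \<mu>"
  obtains a b where "a \<in> Mor ex_cat" "b \<in> Mor ex_cat" "Src ex_cat a = X" "Src ex_cat b = X"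
    "Tgt ex_cat a = oB" "Tgt ex_cat b = oC"
    "ex_gen mc \<cdot>\<^bsub>ex_cat\<^esub> b = ex_gen mb \<cdot>\<^bsub>ex_cat\<^esub> a" "\<mu> = ex_cone a b"
proof -
  obtain h where \<mu>: "\<mu> = (const_functor pullback_shape ex_cat X, ex_F, h)"
    and nat: "two_natural pullback_shape ex_cat (const_functor pullback_shape ex_cat X) ex_F h"
    using assms by (auto simp: is_2cone_def functor_2cat_def diag_def)
  have h: "h i \<in> Mor ex_cat" "Src ex_cat (h i) = X" "Tgt ex_cat (h i) = ex_F_ob i" for i
    using nat by (auto simp: two_natural_def const_functor_def ex_F_def)
  have "ex_F_ar u \<cdot>\<^bsub>ex_cat\<^esub> h (Src pullback_shape u) = h (Tgt pullback_shape u)" for u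
    using nat h by (simp add: two_natural_def const_functor_def ex_F_def)
  from this[of LftArr] this[of RgtArr]
  have apex: "ex_gen mb \<cdot>\<^bsub>ex_cat\<^esub> h Lft = h Apex" "ex_gen mc \<cdot>\<^bsub>ex_cat\<^esub> h Rgt = h Apex"
    by simp_all
  have "h = case_cospan_ob (h Lft) (ex_gen mb \<cdot>\<^bsub>ex_cat\<^esub> h Lft) (h Rgt)"
    by (rule ext) (simp add: apex split: cospan_ob.split)
  then have "\<mu> = ex_cone (h Lft) (h Rgt)"
    by (simp add: \<mu> ex_cone_def h diag_def)
  with h apex show thesis
    by (intro that[of "h Lft" "h Rgt"]) simp_all
qed

text \<open>Postcomposing with \<open>mb\<close> or \<open>mc\<close> adds nothing to
  \<open>f_count\<close>, so the legs have equal counts. Equal source and equal count leave only the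
  three pairs.\<close>

lemma ex_cone_legs:
  assumes "a \<in> Mor ex_cat" "b \<in> Mor ex_cat" "Src ex_cat a = Src ex_cat b"
    "Tgt ex_cat a = oB" "Tgt ex_cat b = oC"
    and eq: "ex_gen mc \<cdot>\<^bsub>ex_cat\<^esub> b = ex_gen mb \<cdot>\<^bsub>ex_cat\<^esub> a"
  shows "a = ex_gen mlam0 \<and> b = ex_gen mlam1 \<or> a = ex_gen malpha0 \<and> b = ex_gen malpha1
    \<or> a = ex_gen mlam0 \<cdot>\<^bsub>ex_cat\<^esub> ex_gen mf \<and> b = ex_gen mlam1 \<cdot>\<^bsub>ex_cat\<^esub> ex_gen mf"
proof -
  have "f_count a = f_count b"
    using arg_cong[OF eq, of f_count] assms(1-5) by (simp add: f_count_Comp)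
  with assms(3) ex_to_oB[OF assms(1,4)] ex_to_oC[OF assms(2,5)] show ?thesis
    by (auto simp: f_count_Comp)
qed

lemma ex_cone_left: "ex_cone a b = ex_cone a' b' \<Longrightarrow> a = a'"
  unfolding ex_cone_def by (metis Pair_inject cospan_ob.case(1))

lemma ex_lam_Comp:
  assumes "f \<in> Mor ex_cat" "Tgt ex_cat f = oL"
  shows "ex_lam \<cdot>\<^bsub>functor_2cat pullback_shape ex_cat\<^esub> fmor (diag pullback_shape ex_cat) f
    = ex_cone (ex_gen mlam0 \<cdot>\<^bsub>ex_cat\<^esub> f) (ex_gen mlam1 \<cdot>\<^bsub>ex_cat\<^esub> f)"
proof -
  have "ex_lam_comp i \<cdot>\<^bsub>ex_cat\<^esub> f = case_cospan_ob (ex_gen mlam0 \<cdot>\<^bsub>ex_cat\<^esub> f)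
      (ex_gen mb \<cdot>\<^bsub>ex_cat\<^esub> (ex_gen mlam0 \<cdot>\<^bsub>ex_cat\<^esub> f)) (ex_gen mlam1 \<cdot>\<^bsub>ex_cat\<^esub> f) i" for i
    using assms by (cases i) (simp_all add: ex.Comp_assoc)
  with assms show ?thesis
    by (auto simp: ex_lam_def ex_cone_def functor_2cat_def nt_comp_def diag_def const_nat_def)
qed

text \<open>A modification between cones amounts to a pair of 2-morphisms between the legs that
  agree after whiskering into A; their common whiskering is the component at
  \<open>Apex\<close>.\<close>

lemma ex_cone_cell:
  assumes st: "s \<in> Cell ex_cat" "t \<in> Cell ex_cat"
    and src: "Src ex_cat (Dm ex_cat s) = X" "Src ex_cat (Dm ex_cat t) = X"
    and tgt: "Tgt ex_cat (Dm ex_cat s) = oB" "Tgt ex_cat (Dm ex_cat t) = oC"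
    and eq: "Idc ex_cat (ex_gen mc) \<star>\<^bsub>ex_cat\<^esub> t = Idc ex_cat (ex_gen mb) \<star>\<^bsub>ex_cat\<^esub> s"
  shows "(ex_cone (Dm ex_cat s) (Dm ex_cat t), ex_cone (Cd ex_cat s) (Cd ex_cat t),
      case_cospan_ob s (Idc ex_cat (ex_gen mb) \<star>\<^bsub>ex_cat\<^esub> s) t)
    \<in> Cell (functor_2cat pullback_shape ex_cat)"
proof -
  \<comment> \<open>The cone conditions for the two ends are the domain and codomain of
    \<open>eq\<close>.\<close>
  have "is_2cone pullback_shape ex_cat ex_F X (ex_cone (Dm ex_cat s) (Dm ex_cat t))"
    using st src tgt arg_cong[OF eq, of "Dm ex_cat"] by (intro ex_cone_is_2cone) simp_all
  moreover have "is_2cone pullback_shape ex_cat ex_F X (ex_cone (Cd ex_cat s) (Cd ex_cat t))"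
    using st src tgt arg_cong[OF eq, of "Cd ex_cat"] by (intro ex_cone_is_2cone) simp_all
  moreover have "modification pullback_shape ex_cat (const_functor pullback_shape ex_cat X) ex_F
      (case_cospan_ob (Dm ex_cat s) (ex_gen mb \<cdot>\<^bsub>ex_cat\<^esub> Dm ex_cat s) (Dm ex_cat t))
      (case_cospan_ob (Cd ex_cat s) (ex_gen mb \<cdot>\<^bsub>ex_cat\<^esub> Cd ex_cat s) (Cd ex_cat t))
      (case_cospan_ob s (Idc ex_cat (ex_gen mb) \<star>\<^bsub>ex_cat\<^esub> s) t)"
    unfolding modification_def
  proof (intro conjI ballI)
    show "Idc ex_cat (fmor ex_F u) \<star>\<^bsub>ex_cat\<^esub>
        (case Src pullback_shape u of Lft \<Rightarrow> s | Apex \<Rightarrow> Idc ex_cat (ex_gen mb) \<star>\<^bsub>ex_cat\<^esub> s | Rgt \<Rightarrow> t)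
      = (case Tgt pullback_shape u of Lft \<Rightarrow> s | Apex \<Rightarrow> Idc ex_cat (ex_gen mb) \<star>\<^bsub>ex_cat\<^esub> s | Rgt \<Rightarrow> t)
        \<star>\<^bsub>ex_cat\<^esub> Idc ex_cat (fmor (const_functor pullback_shape ex_cat X) u)" for u
      using st src tgt eq
      by (cases u) (auto simp: ex_F_def const_functor_def split: cospan_ob.split)
  qed (use st src tgt in \<open>auto split: cospan_ob.split\<close>)
  ultimately show ?thesis
    using st src by (auto simp: is_2cone_def functor_2cat_def ex_cone_def diag_def)
qed

lemma ex_unique_factorisation:
  assumes "is_2cone pullback_shape ex_cat ex_F X \<mu>"
  shows "\<exists>!f. f \<in> Mor ex_cat \<and> Src ex_cat f = X \<and> Tgt ex_cat f = oL \<and>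
    (\<exists>\<phi>\<in>Cell (functor_2cat pullback_shape ex_cat).
       Dm (functor_2cat pullback_shape ex_cat) \<phi>
         = ex_lam \<cdot>\<^bsub>functor_2cat pullback_shape ex_cat\<^esub> fmor (diag pullback_shape ex_cat) f \<and>
       Cd (functor_2cat pullback_shape ex_cat) \<phi> = \<mu>)"
proof -
  \<comment> \<open>Only \<open>Idm ex_cat oL\<close> and \<open>ex_gen mf\<close> end at L, and
    their sources differ.\<close>
  have unique: "f = g"
    if "f \<in> Mor ex_cat" "g \<in> Mor ex_cat" "Src ex_cat f = Src ex_cat g"
      "Tgt ex_cat f = oL" "Tgt ex_cat g = oL" for f g
    using that(3) ex_to_oL[OF that(1,4)] ex_to_oL[OF that(2,5)] by auto
  obtain a b where \<mu>: "\<mu> = ex_cone a b"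
    and ab: "a \<in> Mor ex_cat" "b \<in> Mor ex_cat" "Src ex_cat a = X" "Src ex_cat b = X"
      "Tgt ex_cat a = oB" "Tgt ex_cat b = oC"
      "ex_gen mc \<cdot>\<^bsub>ex_cat\<^esub> b = ex_gen mb \<cdot>\<^bsub>ex_cat\<^esub> a"
    by (rule ex_2cone_cases[OF assms])
  then have legs: "a = ex_gen mlam0 \<and> b = ex_gen mlam1 \<or> a = ex_gen malpha0 \<and> b = ex_gen malpha1
      \<or> a = ex_gen mlam0 \<cdot>\<^bsub>ex_cat\<^esub> ex_gen mf \<and> b = ex_gen mlam1 \<cdot>\<^bsub>ex_cat\<^esub> ex_gen mf"
    by (intro ex_cone_legs) simp_all
  \<comment> \<open>The left leg decides which cone is at hand: the limit cone factors through the
    identity, the other two through \<open>mf\<close>. Only the cone of \<open>malpha0\<close> and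
    \<open>malpha1\<close> needs the cells \<open>gamma0\<close> and \<open>gamma1\<close>;
    elsewhere identities suffice.\<close>
  define f where "f = (if a = ex_gen mlam0 then Idm ex_cat oL else ex_gen mf)"
  define s where "s = (if a = ex_gen malpha0 then ex_gen2 gamma0 else Idc ex_cat a)"
  define t where "t = (if a = ex_gen malpha0 then ex_gen2 gamma1 else Idc ex_cat b)"
  \<comment> \<open>The three left legs are distinct, by source or by \<open>f_count\<close>, so
    each case distinction selects the intended value.\<close>
  have "Src ex_cat (ex_gen mlam0) \<noteq> Src ex_cat (ex_gen malpha0)"
    "f_count (ex_gen mlam0 \<cdot>\<^bsub>ex_cat\<^esub> ex_gen mf) \<noteq> f_count (ex_gen mlam0)"
    "f_count (ex_gen mlam0 \<cdot>\<^bsub>ex_cat\<^esub> ex_gen mf) \<noteq> f_count (ex_gen malpha0)"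
    by (simp_all add: f_count_Comp)
  then have neq: "ex_gen mlam0 \<noteq> ex_gen malpha0"
    "ex_gen mlam0 \<cdot>\<^bsub>ex_cat\<^esub> ex_gen mf \<noteq> ex_gen mlam0"
    "ex_gen mlam0 \<cdot>\<^bsub>ex_cat\<^esub> ex_gen mf \<noteq> ex_gen malpha0"
    by metis+
  have f: "f \<in> Mor ex_cat" "Src ex_cat f = X" "Tgt ex_cat f = oL"
    using legs ab(3) by (elim disjE conjE; simp add: f_def neq neq[symmetric])+
  have st: "s \<in> Cell ex_cat" "t \<in> Cell ex_cat"
      "Dm ex_cat s = ex_gen mlam0 \<cdot>\<^bsub>ex_cat\<^esub> f" "Dm ex_cat t = ex_gen mlam1 \<cdot>\<^bsub>ex_cat\<^esub> f"
      "Cd ex_cat s = a" "Cd ex_cat t = b"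
      "Idc ex_cat (ex_gen mc) \<star>\<^bsub>ex_cat\<^esub> t = Idc ex_cat (ex_gen mb) \<star>\<^bsub>ex_cat\<^esub> s"
    using legs by (elim disjE conjE; simp add: f_def s_def t_def neq neq[symmetric] ex_rel2 ex_rels ex_rels_f)+
  have "\<exists>\<phi>\<in>Cell (functor_2cat pullback_shape ex_cat).
      Dm (functor_2cat pullback_shape ex_cat) \<phi>
        = ex_lam \<cdot>\<^bsub>functor_2cat pullback_shape ex_cat\<^esub> fmor (diag pullback_shape ex_cat) f \<and>
      Cd (functor_2cat pullback_shape ex_cat) \<phi> = \<mu>"
    unfolding \<mu> ex_lam_Comp[OF f(1,3)]
    by (rule bexI[OF _ ex_cone_cell[OF st(1,2) _ _ _ _ st(7)]])
      (use f in \<open>simp_all add: st functor_2cat_def\<close>)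
  with f show ?thesis
    by (intro ex1I[of _ f]) (simp only: simp_thms, rule unique, simp_all only: f)
qed

section \<open>Failure of the 2-limit property\<close>

lemma is_iso_functor_surjective_on_objects:
  "is_iso_functor C D T \<Longrightarrow> surjective_on_objects C D T"
  unfolding is_iso_functor_def is_functor_def surjective_on_objects_def by blast

theorem mainTheorem7:
  shows "two_terminal (lax_slice pullback_shape ex_cat ex_F) (oL, ex_lam)
    \<and> \<not> surjective_on_objects (hom_cat ex_cat oX oL)
        (hom_cat (functor_2cat pullback_shape ex_cat) (fob (diag pullback_shape ex_cat) oX) ex_F)
        (postcomp_diag pullback_shape ex_cat ex_lam)
    \<and> \<not> is_2limit pullback_shape ex_cat ex_F (oL, ex_lam)"
proof -
  let ?H = "hom_cat (functor_2cat pullback_shape ex_cat) (fob (diag pullback_shape ex_cat) oX) ex_F"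
  let ?T = "postcomp_diag pullback_shape ex_cat ex_lam"
  let ?\<alpha> = "ex_cone (ex_gen malpha0) (ex_gen malpha1)"
  have "is_2cone pullback_shape ex_cat ex_F oX ?\<alpha>"
    by (rule ex_cone_is_2cone) (simp_all add: ex_rels)
  then have \<alpha>: "?\<alpha> \<in> Ob ?H"
    by (simp add: is_2cone_def hom_cat_def)
  have "on_ob ?T f \<noteq> ?\<alpha>" if "f \<in> Ob (hom_cat ex_cat oX oL)" for f
  proof
    assume eq: "on_ob ?T f = ?\<alpha>"
    \<comment> \<open>The source X rules out the identity of L.\<close>
    have f: "f \<in> Mor ex_cat" "Tgt ex_cat f = oL" "f = ex_gen mf"
      using that ex_to_oL[of f] by (auto simp: hom_cat_def)
    have "ex_cone (ex_gen mlam0 \<cdot>\<^bsub>ex_cat\<^esub> f) (ex_gen mlam1 \<cdot>\<^bsub>ex_cat\<^esub> f) = ?\<alpha>"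
      using eq by (simp only: postcomp_diag_def ex_lam_Comp[OF f(1,2)] func.simps)
    then have "ex_gen mlam0 \<cdot>\<^bsub>ex_cat\<^esub> ex_gen mf = ex_gen malpha0"
      unfolding f(3) by (rule ex_cone_left)
    from arg_cong[OF this, of f_count] show False
      by (simp add: f_count_Comp)
  qed
  with \<alpha> have not_surj: "\<not> surjective_on_objects (hom_cat ex_cat oX oL) ?H ?T"
    unfolding surjective_on_objects_def by blast
  \<comment> \<open>The 2-limit property at \<open>oX\<close> would make this functor an
    isomorphism, hence surjective on objects.\<close>
  then have "\<not> is_2limit pullback_shape ex_cat ex_F (oL, ex_lam)"
    using is_iso_functor_surjective_on_objects by (force simp: is_2limit_def)
  with not_surj show ?thesis
    using lax_slice_two_terminalI[OF ex_two_category ex_locally_thin ex_lam_is_2cone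
        ex_unique_factorisation] by blast
qed

end
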